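(* For any pair of integers $n \geq 4$ and $m \geq 4$, $\mathrm{mp}(P_n \Box P_m) = \gamma_b(P_n \Box P_m)$, with the exception of the grid $P_4 \Box P_6$ (isomorphic to $P_6 \Box P_4$), for which $\mathrm{mp}(P_4 \Box P_6) = 4$ and $\gamma_b(P_4 \Box P_6) = 5$.
   Context: All graphs are finite, simple and connected; $d(u,v)$ denotes the shortest-path distance, and $N_r(v) = \{u : d(u,v) \leq r\}$ is the ball of radius $r$ around $v$. $P_n \Box P_m$ denotes the Cartesian product of the paths on $n$ and $m$ vertices (the $n \times m$ grid). A dominating broadcast of a graph $G=(V,E)$ is a function $f : V \to \mathbb{N}$ such that for every $u \in V$ there is $v \in V$ with $f(v) > 0$ and $f(v) > d(u,v)$; its cost is $\sum_{v \in V} f(v)$, and $\gamma_b(G)$ (the broadcast number) is the minimum cost of a dominating broadcast of $G$. A multipacking of $G$ is a set $M \subseteq V$ such that for every vertex $v$ and every positive integer $r$, $|N_r(v) \cap M| \leq r$; $\mathrm{mp}(G)$ (the multipacking number) is the maximum size of a multipacking of $G$.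
   Formalization: The covering condition of a dominating broadcast is taken as d(u,v) ≤ f(v) (the standard definition) instead of f(v) > d(u,v); with the strict inequality the claim fails, e.g. for P_4 □ P_4, where mp = 4 but the broadcast number would be 5. *)

theory Defs
  imports "Graph_Theory.Graph_Theory"
begin

text \<open>
  A finite simple graph is, as in the library, a symmetric loop-free digraph without multiple arcs
  (\<^locale>\<open>graph\<close>, or \<^locale>\<open>pair_graph\<close> when arcs are pairs of vertices); each undirected
  edge is represented by its two orientations.
\<close>

definition path_graph :: "nat \<Rightarrow> nat pair_pre_digraph" where
  "path_graph n = \<lparr> pverts = {..<n},
     parcs = {(i, j). i < n \<and> j < n \<and> (j = Suc i \<or> i = Suc j)} \<rparr>"

definition cart_prod ::
  "'a pair_pre_digraph \<Rightarrow> 'b pair_pre_digraph \<Rightarrow> ('a \<times> 'b) pair_pre_digraph" (infixr \<open>\<box>\<close> 80) where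
  "G \<box> H = \<lparr> pverts = pverts G \<times> pverts H,
     parcs = {((a, b), (c, d)). (a = c \<and> a \<in> pverts G \<and> (b, d) \<in> parcs H) \<or>
                                (b = d \<and> b \<in> pverts H \<and> (a, c) \<in> parcs G)} \<rparr>"

text \<open>
  The distance is the infimum of the costs of the walks from \<open>u\<close> to \<open>v\<close> when each arc has weight 1,
  that is, of their lengths.
\<close>

definition graph_dist :: "('a, 'b) pre_digraph \<Rightarrow> 'a \<Rightarrow> 'a \<Rightarrow> ereal" where
  "graph_dist G u v = wf_digraph.\<mu> G (\<lambda>_. 1) u v"

definition graph_ball :: "('a, 'b) pre_digraph \<Rightarrow> nat \<Rightarrow> 'a \<Rightarrow> 'a set" where
  "graph_ball G r v = {u \<in> verts G. graph_dist G u v \<le> ereal (real r)}"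

text \<open>
  A broadcast is a total function, but its values outside the vertex set are never used.
  A vertex \<open>v\<close> with \<open>f v > 0\<close> covers the vertices at distance at most \<open>f v\<close>. The inequality is not
  strict: this is the convention under which broadcasts and multipackings are dual. (With a strict
  inequality the broadcast number of the grid of 4 times 4 vertices would be 5 instead of 4.)
\<close>

definition dominating_broadcast :: "('a, 'b) pre_digraph \<Rightarrow> ('a \<Rightarrow> nat) \<Rightarrow> bool" where
  "dominating_broadcast G f \<longleftrightarrow>
     (\<forall>u \<in> verts G. \<exists>v \<in> verts G. f v > 0 \<and> graph_dist G u v \<le> ereal (real (f v)))"

definition broadcast_cost :: "('a, 'b) pre_digraph \<Rightarrow> ('a \<Rightarrow> nat) \<Rightarrow> nat" where
  "broadcast_cost G f = (\<Sum>v \<in> verts G. f v)"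

definition broadcast_number :: "('a, 'b) pre_digraph \<Rightarrow> nat" where
  "broadcast_number G = (LEAST c. \<exists>f. dominating_broadcast G f \<and> broadcast_cost G f = c)"

definition multipacking :: "('a, 'b) pre_digraph \<Rightarrow> 'a set \<Rightarrow> bool" where
  "multipacking G M \<longleftrightarrow>
     M \<subseteq> verts G \<and> (\<forall>v \<in> verts G. \<forall>r > 0. card (graph_ball G r v \<inter> M) \<le> r)"

definition multipacking_number :: "('a, 'b) pre_digraph \<Rightarrow> nat" where
  "multipacking_number G = Max {card M | M. multipacking G M}"

lemma pair_graph_path_graph: "pair_graph (path_graph n)"
proof
  have "parcs (path_graph n) \<subseteq> {..<n} \<times> {..<n}"
    by (auto simp: path_graph_def)
  then show "finite (parcs (path_graph n))"
    by (rule finite_subset) simp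
qed (auto simp: path_graph_def symmetric_def sym_def)

lemma pair_graph_cart_prod:
  assumes "pair_graph G" "pair_graph H"
  shows "pair_graph (G \<box> H)"
proof -
  interpret G: pair_graph G by fact
  interpret H: pair_graph H by fact
  show ?thesis
  proof
    have "parcs (G \<box> H) \<subseteq> (pverts G \<times> pverts H) \<times> (pverts G \<times> pverts H)"
      by (auto simp: cart_prod_def dest: G.wellformed' H.wellformed')
    then show "finite (parcs (G \<box> H))"
      by (rule finite_subset) (simp add: G.pair_finite_verts H.pair_finite_verts)
  next
    show "symmetric (with_proj (G \<box> H))"
      using G.pair_sym_arcs H.pair_sym_arcs
      by (auto simp: cart_prod_def symmetric_def sym_def)
  qed (auto simp: cart_prod_def G.pair_finite_verts H.pair_finite_verts
      dest: G.wellformed' H.wellformed' G.pair_no_loops H.pair_no_loops)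
qed

lemma strongly_connected_path_graph:
  assumes "n > 0"
  shows "strongly_connected (path_graph n)"
proof (rule strongly_connectedI)
  show "verts (path_graph n) \<noteq> {}"
    using assms by (auto simp: path_graph_def)
next
  interpret pair_graph "path_graph n" by (rule pair_graph_path_graph)
  have to: "0 \<rightarrow>\<^sup>*\<^bsub>path_graph n\<^esub> i" if "i < n" for i
    using that
  proof (induction i)
    case 0
    then have "0 \<in> pverts (path_graph n)" by (simp add: path_graph_def)
    then show ?case by simp
  next
    case (Suc i)
    then have "(i, Suc i) \<in> parcs (path_graph n)"
      by (simp add: path_graph_def)
    with Suc show ?case
      by (metis Suc_lessD reachable_adj_trans with_proj_simps(3))
  qed
  fix u v assume "u \<in> verts (path_graph n)" "v \<in> verts (path_graph n)"
  then have "0 \<rightarrow>\<^sup>*\<^bsub>path_graph n\<^esub> u" "0 \<rightarrow>\<^sup>*\<^bsub>path_graph n\<^esub> v"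
    by (auto simp: path_graph_def intro: to[unfolded path_graph_def])
  then show "u \<rightarrow>\<^sup>*\<^bsub>path_graph n\<^esub> v"
    by (meson pair_sym_arcs symmetric_reachable reachable_trans)
qed

lemma strongly_connected_cart_prod:
  assumes "pair_graph G" "pair_graph H" "strongly_connected G" "strongly_connected H"
  shows "strongly_connected (G \<box> H)"
proof (rule strongly_connectedI)
  show "verts (G \<box> H) \<noteq> {}"
    using assms(3,4) by (auto simp: cart_prod_def strongly_connected_def)
next
  interpret G: pair_graph G by fact
  interpret H: pair_graph H by fact
  interpret GH: pair_graph "G \<box> H" by (rule pair_graph_cart_prod) fact+
  have left: "(a, b) \<rightarrow>\<^sup>*\<^bsub>G \<box> H\<^esub> (c, b)" if "a \<rightarrow>\<^sup>*\<^bsub>G\<^esub> c" "b \<in> pverts H" for a b c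
    using that(1)
  proof (induction rule: G.reachable_induct)
    case base
    then have "(a, b) \<in> pverts (G \<box> H)" using that(2) by (simp add: cart_prod_def)
    then show ?case by simp
  next
    case (step x y)
    then have "((x, b), (y, b)) \<in> parcs (G \<box> H)"
      using that(2) by (simp add: cart_prod_def)
    with step show ?case
      by (metis GH.reachable_adj_trans with_proj_simps(3))
  qed
  have right: "(a, b) \<rightarrow>\<^sup>*\<^bsub>G \<box> H\<^esub> (a, d)" if "b \<rightarrow>\<^sup>*\<^bsub>H\<^esub> d" "a \<in> pverts G" for a b d
    using that(1)
  proof (induction rule: H.reachable_induct)
    case base
    then have "(a, b) \<in> pverts (G \<box> H)" using that(2) by (simp add: cart_prod_def)
    then show ?case by simp
  next
    case (step x y)
    then have "((a, x), (a, y)) \<in> parcs (G \<box> H)"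
      using that(2) by (simp add: cart_prod_def)
    with step show ?case
      by (metis GH.reachable_adj_trans with_proj_simps(3))
  qed
  fix u v assume uv: "u \<in> verts (G \<box> H)" "v \<in> verts (G \<box> H)"
  obtain a b c d where [simp]: "u = (a, b)" "v = (c, d)" by (cases u, cases v)
  have "a \<in> pverts G" "c \<in> pverts G" "b \<in> pverts H" "d \<in> pverts H"
    using uv by (auto simp: cart_prod_def)
  moreover from this have "a \<rightarrow>\<^sup>*\<^bsub>G\<^esub> c" "b \<rightarrow>\<^sup>*\<^bsub>H\<^esub> d"
    using assms(3,4) by (auto simp: strongly_connected_def)
  ultimately show "u \<rightarrow>\<^sup>*\<^bsub>G \<box> H\<^esub> v"
    using left right GH.reachable_trans by simp blast
qed

end

theory Submission
  imports Defs
begin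

text \<open>
  A single central vertex broadcasting with power \<open>n div 2 + m div 2\<close> dominates the grid, so by weak
  duality it suffices to find a multipacking of that size. Clamping a centre to a smaller box only
  shrinks the radius it needs, so one may take \<open>n\<close> and \<open>m\<close> even and count in balls of the whole
  integer plane. Multipackings of the right size are then grown from a few small ones by two moves:
  surround a box by a frame of width 2 and add the four new corners, or lengthen a box of height 4
  or 6 by four columns and add the two new corners. The grids of 4 times 7, 5 times 6 and 5 times 7
  vertices, which shrink to the exceptional grid, get multipackings of their own.

  In the exceptional grid, a multipacking of size 5 must contain all four corners, and then no fifth
  vertex is possible; a fractional multipacking of value 24/5 excludes broadcasts of cost 4.
\<close>

section \<open>Robust packings of boxes\<close>

definition l1_ball :: "int \<Rightarrow> int \<Rightarrow> int \<Rightarrow> (int \<times> int) set" where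
  "l1_ball x y r = {(p, q). \<bar>p - x\<bar> + \<bar>q - y\<bar> \<le> r}"

text \<open>
  \<open>W\<close> and \<open>H\<close> are lengths, so the box has \<open>W + 1\<close> times \<open>H + 1\<close> vertices, both even.
  The slack \<open>j\<close> drives the induction: when a frame is added, a ball may gain a new corner, and this
  gain is paid for because the corner of the inner box is closer to the centre by 4, so that the
  inner packing can be used with \<open>j + 1\<close> in place of \<open>j\<close>. The expression with the two minima is
  the distance from \<open>(x, y)\<close> to the nearest corner of the box.
\<close>

definition robust_packing :: "int \<Rightarrow> int \<Rightarrow> (int \<times> int) set \<Rightarrow> bool" where
  "robust_packing W H M \<longleftrightarrow>
     odd W \<and> odd H \<and> 3 \<le> W \<and> 3 \<le> H \<and> M \<subseteq> {0..W} \<times> {0..H} \<and> 2 * int (card M) = W + H + 2 \<and>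
     (\<forall>x y r j. 0 \<le> x \<longrightarrow> x \<le> W \<longrightarrow> 0 \<le> y \<longrightarrow> y \<le> H \<longrightarrow> 1 \<le> r \<longrightarrow> 0 \<le> j \<longrightarrow>
        j = 0 \<or> min x (W - x) + min y (H - y) + 4 * j \<le> r \<longrightarrow>
        int (card (M \<inter> l1_ball x y r)) + j \<le> r)"

lemma robust_packing_finite: "robust_packing W H M \<Longrightarrow> finite M"
  unfolding robust_packing_def by (metis finite_SigmaI finite_atLeastAtMost_int finite_subset)

lemma robust_packingD:
  assumes "robust_packing W H M" "0 \<le> x" "x \<le> W" "0 \<le> y" "y \<le> H" "1 \<le> r" "0 \<le> j"
    and "j = 0 \<or> min x (W - x) + min y (H - y) + 4 * j \<le> r"
  shows "int (card (M \<inter> l1_ball x y r)) + j \<le> r"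
  using assms unfolding robust_packing_def by blast

section \<open>Centres outside the box\<close>

definition excess :: "int \<Rightarrow> int \<Rightarrow> int" where
  "excess W x = max 0 (- x) + max 0 (x - W)"

lemma abs_diff_clamp:
  "0 \<le> p \<Longrightarrow> p \<le> W \<Longrightarrow> \<bar>p - x\<bar> = \<bar>p - max 0 (min W x)\<bar> + excess W x"
  unfolding excess_def by (auto simp: max_def min_def)

lemma min_dist_ends_clamp:
  fixes W x :: int
  assumes "0 \<le> W"
  defines "x' \<equiv> max 0 (min W x)"
  shows "0 \<le> x'" "x' \<le> W" "min (\<bar>x\<bar>) (\<bar>W - x\<bar>) = min x' (W - x') + excess W x"
  using assms(1) unfolding x'_def excess_def by (auto simp: max_def min_def)

lemma excess_le_min_dist_ends: "0 \<le> W \<Longrightarrow> excess W x \<le> min (\<bar>x\<bar>) (\<bar>W - x\<bar>)"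
  unfolding excess_def by auto

text \<open>Clamping the centre brings every point of the box, and the nearest corner, closer by
  exactly the total excess. The radius drops by as much, so the excess is saved in the bound. The
  strict inequality keeps the reduced radius at least 1.\<close>

lemma robust_packing_clamp:
  assumes R: "robust_packing W H M" and "0 \<le> j" "excess W x + excess H y < r"
    and j: "j = 0 \<or> min (\<bar>x\<bar>) (\<bar>W - x\<bar>) + min (\<bar>y\<bar>) (\<bar>H - y\<bar>) + 4 * j \<le> r"
  shows "int (card (M \<inter> l1_ball x y r)) + j + excess W x + excess H y \<le> r"
proof -
  define x' y' r' where "x' = max 0 (min W x)" and "y' = max 0 (min H y)"
    and "r' = r - excess W x - excess H y"
  have WH: "3 \<le> W" "3 \<le> H" and box: "M \<subseteq> {0..W} \<times> {0..H}"
    using R unfolding robust_packing_def by auto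
  have "M \<inter> l1_ball x y r \<subseteq> M \<inter> l1_ball x' y' r'"
  proof
    fix z assume z: "z \<in> M \<inter> l1_ball x y r"
    obtain p q where [simp]: "z = (p, q)" by (cases z)
    have "0 \<le> p" "p \<le> W" "0 \<le> q" "q \<le> H" "\<bar>p - x\<bar> + \<bar>q - y\<bar> \<le> r"
      using z box by (auto simp: l1_ball_def)
    moreover have "\<bar>p - x\<bar> = \<bar>p - x'\<bar> + excess W x" "\<bar>q - y\<bar> = \<bar>q - y'\<bar> + excess H y"
      using calculation unfolding x'_def y'_def by (intro abs_diff_clamp; simp)+
    ultimately show "z \<in> M \<inter> l1_ball x' y' r'"
      using z by (simp add: l1_ball_def r'_def)
  qed
  then have "card (M \<inter> l1_ball x y r) \<le> card (M \<inter> l1_ball x' y' r')"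
    by (intro card_mono) (auto simp: robust_packing_finite[OF R])
  moreover have "int (card (M \<inter> l1_ball x' y' r')) + j \<le> r'"
  proof (rule robust_packingD[OF R])
    have eq: "min (\<bar>x\<bar>) (\<bar>W - x\<bar>) = min x' (W - x') + excess W x"
      "min (\<bar>y\<bar>) (\<bar>H - y\<bar>) = min y' (H - y') + excess H y"
      using WH unfolding x'_def y'_def by (intro min_dist_ends_clamp(3); simp)+
    show "j = 0 \<or> min x' (W - x') + min y' (H - y') + 4 * j \<le> r'"
      using j unfolding r'_def eq by (simp add: algebra_simps)
  qed (use assms(2,3) WH in \<open>simp_all add: x'_def y'_def r'_def\<close>)
  ultimately show ?thesis
    unfolding r'_def by linarith
qed

text \<open>Either lower corner may stand in for the nearest one; after the symmetry reductions the
  later arguments know only these two distances.\<close>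

lemma robust_packing_clamp':
  assumes R: "robust_packing W H M" and "0 \<le> j" "excess W x + excess H y < r"
    and j: "j = 0 \<or> \<bar>x\<bar> + \<bar>y\<bar> + 4 * j \<le> r \<or> \<bar>W - x\<bar> + \<bar>y\<bar> + 4 * j \<le> r"
  shows "int (card (M \<inter> l1_ball x y r)) + j + excess W x + excess H y \<le> r"
proof (rule robust_packing_clamp[OF assms(1-3)])
  define a b where "a = min (\<bar>x\<bar>) (\<bar>W - x\<bar>)" and "b = min (\<bar>y\<bar>) (\<bar>H - y\<bar>)"
  have "a \<le> \<bar>x\<bar>" "a \<le> \<bar>W - x\<bar>" "b \<le> \<bar>y\<bar>" by (auto simp: a_def b_def)
  then show "j = 0 \<or> min (\<bar>x\<bar>) (\<bar>W - x\<bar>) + min (\<bar>y\<bar>) (\<bar>H - y\<bar>) + 4 * j \<le> r"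
    using j unfolding a_def[symmetric] b_def[symmetric] by auto
qed

text \<open>With no radius left after clamping, the clamped centre is the only point of the box that
  the ball can contain.\<close>

lemma robust_packing_near:
  assumes R: "robust_packing W H M" and "r \<le> excess W x + excess H y"
  shows "card (M \<inter> l1_ball x y r) \<le> 1"
    and "r < excess W x + excess H y \<Longrightarrow> card (M \<inter> l1_ball x y r) = 0"
proof -
  have WH: "3 \<le> W" "3 \<le> H" and box: "M \<subseteq> {0..W} \<times> {0..H}"
    using R unfolding robust_packing_def by auto
  define x' y' where "x' = max 0 (min W x)" and "y' = max 0 (min H y)"
  have *: "excess W x + excess H y \<le> r \<and> z = (x', y')" if "z \<in> M \<inter> l1_ball x y r" for z
  proof -
    obtain p q where [simp]: "z = (p, q)" by (cases z)
    have a: "0 \<le> p" "p \<le> W" "0 \<le> q" "q \<le> H" "\<bar>p - x\<bar> + \<bar>q - y\<bar> \<le> r"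
      using that box by (auto simp: l1_ball_def)
    have b: "\<bar>p - x\<bar> = \<bar>p - x'\<bar> + excess W x" "\<bar>q - y\<bar> = \<bar>q - y'\<bar> + excess H y"
      using a unfolding x'_def y'_def by (intro abs_diff_clamp; simp)+
    show ?thesis
      using a(5)[unfolded b] assms(2) by auto
  qed
  then have "M \<inter> l1_ball x y r \<subseteq> {(x', y')}" by blast
  from card_mono[OF _ this] show "card (M \<inter> l1_ball x y r) \<le> 1" by simp
  assume "r < excess W x + excess H y"
  with * have "M \<inter> l1_ball x y r = {}" by (meson equals0I not_less)
  then show "card (M \<inter> l1_ball x y r) = 0" by simp
qed

text \<open>Frees the centre from the box. When clamping leaves no radius, the nearest corner is at
  distance at least \<open>r\<close>, which forces \<open>j = 0\<close>, and the ball holds at most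
  one point.\<close>

lemma robust_packing_bound:
  assumes R: "robust_packing W H M" and "0 \<le> j" "1 \<le> r"
    and j: "j = 0 \<or> min (\<bar>x\<bar>) (\<bar>W - x\<bar>) + min (\<bar>y\<bar>) (\<bar>H - y\<bar>) + 4 * j \<le> r"
  shows "int (card (M \<inter> l1_ball x y r)) + j \<le> r"
proof (cases "excess W x + excess H y < r")
  case True
  have "0 \<le> excess W x" "0 \<le> excess H y" by (auto simp: excess_def)
  with robust_packing_clamp[OF R assms(2) True j] show ?thesis by linarith
next
  case False
  have "3 \<le> W" "3 \<le> H" using R unfolding robust_packing_def by auto
  then have "excess W x + excess H y \<le> min (\<bar>x\<bar>) (\<bar>W - x\<bar>) + min (\<bar>y\<bar>) (\<bar>H - y\<bar>)"
    by (intro add_mono excess_le_min_dist_ends) auto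
  then have "j = 0" using False j assms(2) by force
  then show ?thesis using robust_packing_near(1)[OF R, of r x y] False assms(3) by simp
qed

section \<open>Symmetries of boxes\<close>

lemma card_image_Int:
  assumes "M = f ` N" "inj f" "\<And>z. f z \<in> B \<longleftrightarrow> z \<in> C"
  shows "card (M \<inter> B) = card (N \<inter> C)"
proof -
  have "M \<inter> B = f ` (N \<inter> C)" using assms by auto
  then show ?thesis using card_image[OF inj_on_subset[OF assms(2)]] by simp
qed

definition flip :: "int \<Rightarrow> int \<times> int \<Rightarrow> int \<times> int" where
  "flip W = (\<lambda>(p, q). (W - p, q))"

lemma inj_flip: "inj (flip W)"
  by (auto simp: flip_def inj_def)

lemma card_flip: "card (flip W ` M \<inter> l1_ball x y r) = card (M \<inter> l1_ball (W - x) y r)"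
  by (rule card_image_Int[OF refl inj_flip]) (auto simp: flip_def l1_ball_def)

lemma card_swap: "card (prod.swap ` M \<inter> l1_ball x y r) = card (M \<inter> l1_ball y x r)"
  by (rule card_image_Int[OF refl]) (auto simp: l1_ball_def)

text \<open>The condition on centres sees only the set of the four corners. Together with the
  transposition below, this lets later arguments restrict the centre to a part of the box.\<close>

lemma robust_packing_flip:
  assumes "robust_packing W H M"
  shows "robust_packing W H (flip W ` M)"
  unfolding robust_packing_def
proof (intro conjI allI impI)
  show "flip W ` M \<subseteq> {0..W} \<times> {0..H}" "2 * int (card (flip W ` M)) = W + H + 2"
    using assms card_image[OF inj_on_subset[OF inj_flip], of M]
    by (auto simp: robust_packing_def flip_def)
  fix x y r j :: int
  assume "0 \<le> x" "x \<le> W" "0 \<le> y" "y \<le> H" "1 \<le> r" "0 \<le> j"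
    "j = 0 \<or> min x (W - x) + min y (H - y) + 4 * j \<le> r"
  then show "int (card (flip W ` M \<inter> l1_ball x y r)) + j \<le> r"
    unfolding card_flip by (intro robust_packingD[OF assms]) (auto simp: min.commute)
qed (use assms in \<open>auto simp: robust_packing_def\<close>)

lemma robust_packing_swap:
  assumes "robust_packing W H M"
  shows "robust_packing H W (prod.swap ` M)"
  unfolding robust_packing_def
proof (intro conjI allI impI)
  show "prod.swap ` M \<subseteq> {0..H} \<times> {0..W}" "2 * int (card (prod.swap ` M)) = H + W + 2"
    using assms by (auto simp: robust_packing_def card_image)
  fix x y r j :: int
  assume "0 \<le> x" "x \<le> H" "0 \<le> y" "y \<le> W" "1 \<le> r" "0 \<le> j"
    "j = 0 \<or> min x (H - x) + min y (W - y) + 4 * j \<le> r"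
  then show "int (card (prod.swap ` M \<inter> l1_ball x y r)) + j \<le> r"
    unfolding card_swap by (intro robust_packingD[OF assms]) (auto simp: add.commute)
qed (use assms in \<open>auto simp: robust_packing_def\<close>)


section \<open>Adding a frame\<close>

definition frame :: "int \<Rightarrow> int \<Rightarrow> (int \<times> int) set \<Rightarrow> (int \<times> int) set" where
  "frame W H M = {(0, 0), (W + 4, 0), (0, H + 4), (W + 4, H + 4)} \<union> (\<lambda>(p, q). (p + 2, q + 2)) ` M"

text \<open>Inclusion of the balls is asked only at points of the box. A centre can thus move across
  the box while the radius shrinks, as long as the smaller ball covers the part left behind.\<close>

lemma card_ball_le:
  assumes "M \<subseteq> {0..W} \<times> {0..H}"
    and "\<And>p q. 0 \<le> p \<Longrightarrow> p \<le> W \<Longrightarrow> 0 \<le> q \<Longrightarrow> q \<le> H \<Longrightarrow> \<bar>p - x\<bar> + \<bar>q - y\<bar> \<le> r \<Longrightarrow> \<bar>p - x'\<bar> + \<bar>q - y'\<bar> \<le> r'"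
  shows "card (M \<inter> l1_ball x y r) \<le> card (M \<inter> l1_ball x' y' r')"
proof (rule card_mono)
  show "finite (M \<inter> l1_ball x' y' r')" using finite_subset[OF assms(1)] by simp
  show "M \<inter> l1_ball x y r \<subseteq> M \<inter> l1_ball x' y' r'"
    using assms by (auto simp: l1_ball_def)
qed

lemma card_frame_ball:
  assumes "finite M"
  shows "card (frame W H M \<inter> l1_ball x y r) \<le>
    card ({(0, 0), (W + 4, 0), (0, H + 4), (W + 4, H + 4)} \<inter> l1_ball x y r)
     + card (M \<inter> l1_ball (x - 2) (y - 2) r)"
proof -
  have "card ((\<lambda>(p, q). (p + 2, q + 2)) ` M \<inter> l1_ball x y r) = card (M \<inter> l1_ball (x - 2) (y - 2) r)"
    by (rule card_image_Int[OF refl]) (auto simp: l1_ball_def inj_def)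
  then show ?thesis
    unfolding frame_def Int_Un_distrib2 by (metis card_Un_le)
qed

lemma card_frame:
  assumes "M \<subseteq> {0..W} \<times> {0..H}" "0 \<le> W" "0 \<le> H"
  shows "card (frame W H M) = card M + 4"
proof -
  have "card (frame W H M) = card {(0, 0), (W + 4, 0), (0, H + 4), (W + 4, H + 4)} +
      card ((\<lambda>(p, q). (p + 2, q + 2)) ` M)"
    unfolding frame_def
    by (rule card_Un_disjoint) (use assms finite_subset[OF assms(1)] in auto)
  also have "card ((\<lambda>(p, q). (p + 2, q + 2)) ` M) = card M"
    by (rule card_image) (auto simp: inj_on_def)
  finally show ?thesis using assms by simp
qed

lemma frame_flip: "frame W H (flip W ` M) = flip (W + 4) ` frame W H M"
proof -
  have "(\<lambda>(p, q). (p + 2, q + 2)) ` flip W ` M = flip (W + 4) ` (\<lambda>(p, q). (p + 2, q + 2)) ` M"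
    unfolding image_image by (rule image_cong) (auto simp: flip_def)
  then show ?thesis
    unfolding frame_def image_Un by (auto simp: flip_def)
qed

lemma frame_swap: "frame H W (prod.swap ` M) = prod.swap ` frame W H M"
  unfolding frame_def image_Un image_image by (auto simp: case_prod_beta)

text \<open>Each new corner in the ball costs one unit. It is paid for by a larger slack or an
  excess, by moving the centre so that the radius shrinks, or by comparing \<open>r\<close> with the
  total size.\<close>

lemma frame_card_aux:
  assumes R: "robust_packing W H M" and "1 \<le> r" "0 \<le> j"
    and x: "0 \<le> x" "2 * x \<le> W + 4" and y: "0 \<le> y" "2 * y \<le> H + 4"
    and xy: "W - x + y \<le> H - y + x"
    and j: "j = 0 \<or> x + y + 4 * j \<le> r"
  shows "int (card (frame W H M \<inter> l1_ball x y r)) + j \<le> r"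
proof -
  let ?C = "{(0, 0), (W + 4, 0), (0, H + 4), (W + 4, H + 4)}"
  let ?k = "card (?C \<inter> l1_ball x y r)"
  let ?c = "card (frame W H M \<inter> l1_ball x y r)"
  have fin: "finite M" using R by (rule robust_packing_finite)
  have box: "M \<subseteq> {0..W} \<times> {0..H}" and WH: "3 \<le> W" "3 \<le> H" "odd W" "odd H"
    and size: "2 * int (card M) = W + H + 2"
    using R unfolding robust_packing_def by auto
  have split: "?c \<le> ?k + card (M \<inter> l1_ball (x - 2) (y - 2) r)"
    by (rule card_frame_ball[OF fin])
  have total: "2 * int (card (frame W H M)) = W + H + 10"
    using card_frame[OF box] WH size by simp
  have finF: "finite (frame W H M)" using fin by (simp add: frame_def)
  \<comment> \<open>Both lengths are odd, so no centre lies on a midline; this gives the last unit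
    when the ball contains all four corners.\<close>
  have strict: "2 * x \<noteq> W + 4" "2 * y \<noteq> H + 4" using WH by presburger+
  txt \<open>By the choice of the octant, the corners enter the ball in a fixed order.\<close>
  consider "r < x + y" | "x + y \<le> r" "r < W + 4 - x + y" | "W + 4 - x + y \<le> r" "r < H + 4 - y + x"
    | "H + 4 - y + x \<le> r" "r < W + H + 8 - x - y" | "W + H + 8 - x - y \<le> r"
    by linarith
  then show ?thesis
  proof cases
    case 1
    then have "?C \<inter> l1_ball x y r = {}" using x y xy by (auto simp: l1_ball_def)
    moreover have "int (card (M \<inter> l1_ball (x - 2) (y - 2) r)) + 0 \<le> r"
      by (rule robust_packing_bound[OF R]) (use assms in auto)
    ultimately show ?thesis using split j 1 \<open>0 \<le> j\<close> by auto
  next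
    case 2
    then have "?C \<inter> l1_ball x y r = {(0, 0)}" using x y xy by (auto simp: l1_ball_def)
    then have k: "?k = 1" by simp
    define d where "d = excess W (x - 2) + excess H (y - 2)"
    have d: "d = max 0 (2 - x) + max 0 (2 - y)"
      using x y WH unfolding d_def excess_def by auto
    show ?thesis
    proof (cases "d < r")
      case True
      \<comment> \<open>If the shifted centre lies in the inner box, the inner corner is closer by 4
        and slack \<open>j + 1\<close> is available. Otherwise \<open>d\<close> makes up for the
        smaller slack.\<close>
      define j' where "j' = (if d = 0 then j + 1 else if 2 \<le> d then max 0 (j - 1) else j)"
      have "int (card (M \<inter> l1_ball (x - 2) (y - 2) r)) + j' + d \<le> r"
        unfolding d_def add.assoc[symmetric]
      proof (rule robust_packing_clamp'[OF R])
        show "j' = 0 \<or> \<bar>x - 2\<bar> + \<bar>y - 2\<bar> + 4 * j' \<le> r \<or> \<bar>W - (x - 2)\<bar> + \<bar>y - 2\<bar> + 4 * j' \<le> r"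
          using j 2 x y \<open>0 \<le> j\<close> unfolding j'_def d by (auto simp: max_def abs_if split: if_splits)
      qed (use True \<open>0 \<le> j\<close> in \<open>auto simp: j'_def d_def\<close>)
      moreover have "j + 1 \<le> j' + d" unfolding j'_def d using \<open>0 \<le> j\<close> by auto
      ultimately show ?thesis using split k by linarith
    next
      case False
      then have near: "card (M \<inter> l1_ball (x - 2) (y - 2) r) \<le> 1"
        "r < d \<Longrightarrow> card (M \<inter> l1_ball (x - 2) (y - 2) r) = 0"
        using robust_packing_near[OF R, of r "x - 2" "y - 2"] unfolding d_def by auto
      show ?thesis
      proof (cases "r < d")
        case True
        then have "1 + j \<le> r" using j 2 x y \<open>1 \<le> r\<close> by linarith
        then show ?thesis using split k near(2)[OF True] by linarith
      next
        case F: False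
        \<comment> \<open>\<open>r = d\<close> and \<open>x + y \<le> r\<close> force
          \<open>r \<ge> 2\<close>, and slack 1 is possible only for \<open>r = 4\<close>.\<close>
        have "2 + j \<le> r" using F False j 2 x y \<open>0 \<le> j\<close> unfolding d by (auto simp: max_def split: if_splits)
        then show ?thesis using split k near(1) by linarith
      qed
    qed
  next
    case 3
    then have "?C \<inter> l1_ball x y r = {(0, 0), (W + 4, 0)}" using x y xy by (auto simp: l1_ball_def)
    then have k: "?k = 2" using WH by simp
    \<comment> \<open>Raising the centre by 2 loses nothing: points at or above the new height get
      closer by 2, and the smaller ball reaches both lower corners, hence all points below. The two
      units saved pay for the two new corners.\<close>
    have "card (M \<inter> l1_ball (x - 2) (y - 2) r) \<le> card (M \<inter> l1_ball (x - 2) y (r - 2))"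
      by (rule card_ball_le[OF box]) (use 3 x y in linarith)
    moreover define j' where "j' = (if 2 \<le> x then j else max 0 (j - 1))"
    have "int (card (M \<inter> l1_ball (x - 2) y (r - 2))) + j' + excess W (x - 2) + excess H y \<le> r - 2"
    proof (rule robust_packing_clamp'[OF R])
      show "j' = 0 \<or> \<bar>x - 2\<bar> + \<bar>y\<bar> + 4 * j' \<le> r - 2 \<or> \<bar>W - (x - 2)\<bar> + \<bar>y\<bar> + 4 * j' \<le> r - 2"
        using j 3 x y \<open>0 \<le> j\<close> unfolding j'_def by (auto simp: max_def abs_if split: if_splits)
    qed (use 3 x y WH \<open>0 \<le> j\<close> in \<open>auto simp: j'_def excess_def\<close>)
    moreover have "j \<le> j' + excess W (x - 2)" "0 \<le> excess H y"
      unfolding j'_def using x \<open>0 \<le> j\<close> by (auto simp: excess_def)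
    ultimately show ?thesis using split k by linarith
  next
    case 4
    then have C: "?C \<inter> l1_ball x y r = {(0, 0), (W + 4, 0), (0, H + 4)}"
      using x y xy by (auto simp: l1_ball_def)
    then have k: "?k = 3" using WH by simp
    show ?thesis
    proof (cases "j = 0")
      case True
      \<comment> \<open>Without slack it is enough to leave out the far corner: the distances to
        \<open>(W + 4, 0)\<close> and \<open>(0, H + 4)\<close> add up to \<open>W + H + 8\<close>,
        and the second, which is not smaller, is at most \<open>r\<close>.\<close>
      have "frame W H M \<inter> l1_ball x y r \<subseteq> frame W H M - {(W + 4, H + 4)}"
      proof -
        have "(W + 4, H + 4) \<notin> l1_ball x y r" using 4 x y by (auto simp: l1_ball_def)
        then show ?thesis by blast
      qed
      then have "?c \<le> card (frame W H M - {(W + 4, H + 4)})"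
        using finF by (intro card_mono) auto
      also have "\<dots> = card (frame W H M) - 1"
        by (subst card_Diff_singleton) (auto simp: frame_def)
      finally have "2 * int ?c \<le> W + H + 8" using total WH by linarith
      then show ?thesis using True 4 xy by linarith
    next
      case False
      \<comment> \<open>The centre moves by 2 in both directions towards the missing corner;
        positive \<open>j\<close> gives \<open>x + y \<le> r - 4\<close>, so the opposite corner
        stays covered. The four units saved pay for three corners and one unit of slack.\<close>
      have "card (M \<inter> l1_ball (x - 2) (y - 2) r) \<le> card (M \<inter> l1_ball x y (r - 4))"
        by (rule card_ball_le[OF box]) (use False j \<open>0 \<le> j\<close> 4 x y xy in linarith)
      moreover have "int (card (M \<inter> l1_ball x y (r - 4))) + (j - 1) \<le> r - 4"
        by (rule robust_packing_bound[OF R]) (use False j \<open>0 \<le> j\<close> 4 x y xy WH in auto)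
      ultimately show ?thesis using split k by linarith
    qed
  next
    case 5
    have "?c \<le> card (frame W H M)" using finF by (intro card_mono) auto
    then have "2 * int ?c \<le> W + H + 10" using total by linarith
    then show ?thesis using 5 j \<open>0 \<le> j\<close> x y strict by linarith
  qed
qed

lemma robust_packing_frame:
  assumes R: "robust_packing W H M"
  shows "robust_packing (W + 4) (H + 4) (frame W H M)"
  unfolding robust_packing_def
proof (intro conjI allI impI)
  have box: "M \<subseteq> {0..W} \<times> {0..H}" and WH: "3 \<le> W" "3 \<le> H" "odd W" "odd H"
    and size: "2 * int (card M) = W + H + 2"
    using R unfolding robust_packing_def by auto
  show "3 \<le> W + 4" "3 \<le> H + 4" "odd (W + 4)" "odd (H + 4)"
    "frame W H M \<subseteq> {0..W + 4} \<times> {0..H + 4}"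
    "2 * int (card (frame W H M)) = W + 4 + (H + 4) + 2"
    using WH size box card_frame[OF box] by (auto simp: frame_def)
  \<comment> \<open>Transposition extends the octant to the lower left quarter, and reflection in
    \<open>left\<close> to the lower half.\<close>
  have low: "int (card (frame W H M \<inter> l1_ball x y r)) + j \<le> r"
    if "robust_packing W H M" "1 \<le> r" "0 \<le> j" "0 \<le> x" "2 * x \<le> W + 4" "0 \<le> y" "2 * y \<le> H + 4"
      "j = 0 \<or> x + y + 4 * j \<le> r" for W H M x y r j
  proof (cases "W - x + y \<le> H - y + x")
    case True
    then show ?thesis using frame_card_aux that by blast
  next
    case False
    have "int (card (frame H W (prod.swap ` M) \<inter> l1_ball y x r)) + j \<le> r"
      by (rule frame_card_aux[OF robust_packing_swap[OF that(1)]]) (use False that in auto)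
    then show ?thesis unfolding frame_swap card_swap .
  qed
  have left: "int (card (frame W H M \<inter> l1_ball x y r)) + j \<le> r"
    if "robust_packing W H M" "1 \<le> r" "0 \<le> j" "0 \<le> x" "x \<le> W + 4" "0 \<le> y" "2 * y \<le> H + 4"
      "j = 0 \<or> min x (W + 4 - x) + y + 4 * j \<le> r" for W H M x y r j
  proof (cases "2 * x \<le> W + 4")
    case True
    then show ?thesis using low that by auto
  next
    case False
    have "int (card (frame W H (flip W ` M) \<inter> l1_ball (W + 4 - x) y r)) + j \<le> r"
      by (rule low[OF robust_packing_flip[OF that(1)]]) (use False that in auto)
    then show ?thesis unfolding frame_flip card_flip by simp
  qed
  fix x y r j :: int
  assume *: "0 \<le> x" "x \<le> W + 4" "0 \<le> y" "y \<le> H + 4" "1 \<le> r" "0 \<le> j"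
    "j = 0 \<or> min x (W + 4 - x) + min y (H + 4 - y) + 4 * j \<le> r"
  show "int (card (frame W H M \<inter> l1_ball x y r)) + j \<le> r"
  proof (cases "2 * y \<le> H + 4")
    case True
    then show ?thesis using left[OF R] * by auto
  next
    case False
    have "int (card (frame H W (prod.swap ` M) \<inter> l1_ball y x r)) + j \<le> r"
    proof -
      \<comment> \<open>The reflection exchanging top and bottom is \<open>flip\<close> conjugated
        by \<open>prod.swap\<close>.\<close>
      let ?N = "flip H ` prod.swap ` M"
      have R': "robust_packing W H (prod.swap ` ?N)"
        by (intro robust_packing_swap robust_packing_flip R)
      have "int (card (frame W H (prod.swap ` ?N) \<inter> l1_ball x (H + 4 - y) r)) + j \<le> r"
        by (rule left[OF R']) (use False * in auto)
      then show ?thesis unfolding frame_swap card_swap frame_flip card_flip by simp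
    qed
    then show ?thesis unfolding frame_swap card_swap .
  qed
qed


section \<open>Lengthening a strip\<close>

definition extend :: "int \<Rightarrow> int \<Rightarrow> (int \<times> int) set \<Rightarrow> (int \<times> int) set" where
  "extend W H M = {(W + 4, 0), (W + 4, H)} \<union> M"

text \<open>
  Two triangles at the right end of the strip contain no point but their corner. This is what makes
  room for the balls centred near a long side that reach only one of the two new corners.
\<close>

definition bare_end :: "int \<Rightarrow> int \<Rightarrow> (int \<times> int) set \<Rightarrow> bool" where
  "bare_end W H M \<longleftrightarrow> (\<forall>(p, q) \<in> M.
     (2 * (W - p) + H - 1 \<le> 2 * q \<longrightarrow> (p, q) = (W, H)) \<and>
     (2 * (W - p) + H - 1 \<le> 2 * (H - q) \<longrightarrow> (p, q) = (W, 0)))"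

lemma card_extend_ball:
  assumes "finite M"
  shows "card (extend W H M \<inter> l1_ball x y r) \<le>
    card ({(W + 4, 0), (W + 4, H)} \<inter> l1_ball x y r) + card (M \<inter> l1_ball x y r)"
  unfolding extend_def Int_Un_distrib2 by (metis card_Un_le)

lemma card_extend:
  assumes "M \<subseteq> {0..W} \<times> {0..H}" "0 < H"
  shows "card (extend W H M) = card M + 2"
proof -
  have "card (extend W H M) = card {(W + 4, 0), (W + 4, H)} + card M"
    unfolding extend_def
    by (rule card_Un_disjoint) (use assms finite_subset[OF assms(1)] in auto)
  then show ?thesis using assms by simp
qed

text \<open>The centre is moved left, and the radius reduced, by one for each point to be paid for:
  the new corners and possibly \<open>(W, H)\<close>. If both corners are in the ball and the centre
  is in the first two columns, the total size is compared with \<open>r\<close> instead.\<close>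

lemma extend_card_aux:
  assumes R: "robust_packing W H M" and E: "bare_end W H M" and "H = 3 \<or> H = 5" "H \<le> W"
    and "1 \<le> r" "0 \<le> j" and x: "0 \<le> x" "x \<le> W + 4" and y: "0 \<le> y" "2 * y \<le> H"
    and j: "j = 0 \<or> x + y + 4 * j \<le> r \<or> W + 4 - x + y + 4 * j \<le> r"
  shows "int (card (extend W H M \<inter> l1_ball x y r)) + j \<le> r"
proof -
  let ?C = "{(W + 4, 0), (W + 4, H)}"
  let ?k = "card (?C \<inter> l1_ball x y r)"
  let ?c = "card (extend W H M \<inter> l1_ball x y r)"
  have fin: "finite M" using R by (rule robust_packing_finite)
  have box: "M \<subseteq> {0..W} \<times> {0..H}" and WH: "3 \<le> W" "3 \<le> H"
    and size: "2 * int (card M) = W + H + 2"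
    using R unfolding robust_packing_def by auto
  have split: "?c \<le> ?k + card (M \<inter> l1_ball x y r)"
    by (rule card_extend_ball[OF fin])
  have H5: "H \<le> 5" using assms(3) by auto
  have Hy: "excess H y = 0" using y WH by (auto simp: excess_def)
  consider "r < W + 4 - x + y" | "W + 4 - x + y \<le> r" "r < W + 4 - x + H - y" | "W + 4 - x + H - y \<le> r"
    by linarith
  then show ?thesis
  proof cases
    case 1
    then have k: "?C \<inter> l1_ball x y r = {}" using x y by (auto simp: l1_ball_def)
    have "min (\<bar>x\<bar>) (\<bar>W - x\<bar>) \<le> x" "min (\<bar>y\<bar>) (\<bar>H - y\<bar>) \<le> y" using x y by auto
    then have "int (card (M \<inter> l1_ball x y r)) + j \<le> r"
      by (intro robust_packing_bound[OF R]) (use assms 1 in auto)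
    then show ?thesis using split k by simp
  next
    case 2
    then have C: "?C \<inter> l1_ball x y r = {(W + 4, 0)}" using x y by (auto simp: l1_ball_def)
    then have k: "?k = 1" by simp
    show ?thesis
    proof (cases "M \<inter> l1_ball x y r \<subseteq> l1_ball (x - 1) y (r - 1)")
      case True
      then have le: "card (M \<inter> l1_ball x y r) \<le> card (M \<inter> l1_ball (x - 1) y (r - 1))"
        using fin by (intro card_mono) auto
      define d where "d = excess W (x - 1)"
      have d: "d = max 0 (1 - x) + max 0 (x - 1 - W)" unfolding d_def excess_def by simp
      show ?thesis
      proof (cases "d < r - 1")
        case True
        \<comment> \<open>A unit of slack may be given up once the moved centre leaves the old box,
          because the excess \<open>d\<close> returns it.\<close>
        define j' where "j' = (if d = 0 then j else max 0 (j - 1))"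
        have "int (card (M \<inter> l1_ball (x - 1) y (r - 1))) + j' + excess W (x - 1) + excess H y \<le> r - 1"
        proof (rule robust_packing_clamp'[OF R])
          show "j' = 0 \<or> \<bar>x - 1\<bar> + \<bar>y\<bar> + 4 * j' \<le> r - 1 \<or> \<bar>W - (x - 1)\<bar> + \<bar>y\<bar> + 4 * j' \<le> r - 1"
            using j 2 x y \<open>0 \<le> j\<close> unfolding j'_def d by (auto simp: max_def abs_if split: if_splits)
        qed (use True \<open>0 \<le> j\<close> Hy in \<open>auto simp: j'_def d_def\<close>)
        moreover have "j \<le> j' + d" unfolding j'_def d using \<open>0 \<le> j\<close> by auto
        ultimately show ?thesis using split k le Hy unfolding d_def by linarith
      next
        case False
        have near: "card (M \<inter> l1_ball (x - 1) y (r - 1)) \<le> 1"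
          "r - 1 < d \<Longrightarrow> card (M \<inter> l1_ball (x - 1) y (r - 1)) = 0"
          using robust_packing_near[OF R, of "r - 1" "x - 1" y] False Hy unfolding d_def by auto
        have "1 + j \<le> r" "r - 1 = d \<Longrightarrow> 2 + j \<le> r"
          using False j 2 x y WH \<open>0 \<le> j\<close> \<open>1 \<le> r\<close> unfolding d by linarith+
        then show ?thesis using split k le near False by fastforce
      qed
    next
      case False
      then obtain p q where pq: "(p, q) \<in> M" "\<bar>p - x\<bar> + \<bar>q - y\<bar> \<le> r" "r - 1 < \<bar>p - (x - 1)\<bar> + \<bar>q - y\<bar>"
        unfolding l1_ball_def by (force simp: not_le)
      then have *: "0 \<le> p" "p \<le> W" "0 \<le> q" "q \<le> H" using box by auto
      have "x \<le> p" "y < q" using pq(2,3) * 2 x y by linarith+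
      \<comment> \<open>As the ball reaches \<open>(W + 4, 0)\<close>, a point that escapes the move
        has \<open>q \<ge> W - p + 3\<close>. Since \<open>H - 1 \<le> 4\<close>, it lies in the
        upper bare triangle and is the corner \<open>(W, H)\<close>.\<close>
      then have "2 * (W - p) + H - 1 \<le> 2 * q" using pq(3) 2(1) y(1) H5 by simp
      then have [simp]: "p = W" "q = H" using E pq(1) unfolding bare_end_def by auto
      have top: "r + x + y < W + H + 2" "W + H \<le> r + x + y" "x \<le> W"
        using pq(2,3) * 2 x y \<open>x \<le> p\<close> \<open>y < q\<close> by auto
      \<comment> \<open>Moving a second column to the left loses only \<open>(W, H)\<close>, since
        all other points of \<open>M\<close> lie strictly below the slanted edge of the triangle.
        The two units saved pay for \<open>(W + 4, 0)\<close> and \<open>(W, H)\<close>.\<close>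
      have "M \<inter> l1_ball x y r \<subseteq> insert (W, H) (M \<inter> l1_ball (x - 2) y (r - 2))"
      proof
        fix z assume z: "z \<in> M \<inter> l1_ball x y r"
        obtain s t where zst [simp]: "z = (s, t)" by (cases z)
        have st: "(s, t) \<in> M" "\<bar>s - x\<bar> + \<bar>t - y\<bar> \<le> r" using z by (auto simp: l1_ball_def)
        then have "0 \<le> s" "s \<le> W" "0 \<le> t" "t \<le> H" using box by auto
        show "z \<in> insert (W, H) (M \<inter> l1_ball (x - 2) y (r - 2))"
        proof (cases "(s, t) = (W, H)")
          case False
          then have "2 * t < 2 * (W - s) + H - 1"
            using E st(1) unfolding bare_end_def by fastforce
          then have "s + t \<le> r + x + y - 4" using top 2 y(1) assms(3) by auto
          then have "\<bar>s - (x - 2)\<bar> + \<bar>t - y\<bar> \<le> r - 2"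
            using st(2) \<open>s \<le> W\<close> \<open>0 \<le> t\<close> 2(1) by linarith
          then show ?thesis using st by (simp add: l1_ball_def)
        qed simp
      qed
      then have "card (M \<inter> l1_ball x y r) \<le> card (insert (W, H) (M \<inter> l1_ball (x - 2) y (r - 2)))"
        using fin by (intro card_mono) auto
      also have "\<dots> \<le> card (M \<inter> l1_ball (x - 2) y (r - 2)) + 1"
        using fin by (simp add: card_insert_if)
      finally have le: "card (M \<inter> l1_ball x y r) \<le> card (M \<inter> l1_ball (x - 2) y (r - 2)) + 1" .
      define j' where "j' = (if 2 \<le> x then j else max 0 (j - 1))"
      have "int (card (M \<inter> l1_ball (x - 2) y (r - 2))) + j' + excess W (x - 2) + excess H y \<le> r - 2"
      proof (rule robust_packing_clamp'[OF R])
        show "excess W (x - 2) + excess H y < r - 2"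
          using Hy x WH top 2 by (auto simp: excess_def)
        show "j' = 0 \<or> \<bar>x - 2\<bar> + \<bar>y\<bar> + 4 * j' \<le> r - 2 \<or> \<bar>W - (x - 2)\<bar> + \<bar>y\<bar> + 4 * j' \<le> r - 2"
          using j 2 x y top assms(3) \<open>0 \<le> j\<close> unfolding j'_def by (auto simp: max_def abs_if split: if_splits)
      qed (use \<open>0 \<le> j\<close> in \<open>auto simp: j'_def\<close>)
      moreover have "j \<le> j' + excess W (x - 2)"
        unfolding j'_def using x \<open>0 \<le> j\<close> by (auto simp: excess_def)
      ultimately show ?thesis using split k le Hy by linarith
    qed
  next
    case 3
    then have "?C \<inter> l1_ball x y r = ?C" using x y by (auto simp: l1_ball_def)
    then have k: "?k = 2" using WH by simp
    show ?thesis
    proof (cases "x < 2")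
      case True
      have "?c \<le> card (extend W H M)" using fin by (intro card_mono) (auto simp: extend_def)
      then have "2 * int ?c \<le> W + H + 6" using card_extend[OF box] size WH by linarith
      then show ?thesis using True 3 j x y WH \<open>0 \<le> j\<close> by linarith
    next
      case False
      \<comment> \<open>Points at or left of the new centre get closer by 2; those to its right are
        within \<open>r - 2\<close> because the ball reaches \<open>(W + 4, H)\<close>.\<close>
      have le: "card (M \<inter> l1_ball x y r) \<le> card (M \<inter> l1_ball (x - 2) y (r - 2))"
        by (rule card_ball_le[OF box]) (use 3 x y in linarith)
      define d where "d = excess W (x - 2)"
      have d: "d = max 0 (x - 2 - W)" using False unfolding d_def excess_def by simp
      show ?thesis
      proof (cases "d < r - 2")
        case True
        define j' where "j' = (if d = 0 then j else max 0 (j - 1))"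
        have "int (card (M \<inter> l1_ball (x - 2) y (r - 2))) + j' + excess W (x - 2) + excess H y \<le> r - 2"
        proof (rule robust_packing_clamp'[OF R])
          show "j' = 0 \<or> \<bar>x - 2\<bar> + \<bar>y\<bar> + 4 * j' \<le> r - 2 \<or> \<bar>W - (x - 2)\<bar> + \<bar>y\<bar> + 4 * j' \<le> r - 2"
            using j 3 x y False \<open>0 \<le> j\<close> unfolding j'_def d by (auto simp: max_def abs_if split: if_splits)
        qed (use True \<open>0 \<le> j\<close> Hy in \<open>auto simp: j'_def d_def\<close>)
        moreover have "j \<le> j' + d" unfolding j'_def d using \<open>0 \<le> j\<close> by auto
        ultimately show ?thesis using split k le Hy unfolding d_def by linarith
      next
        case F: False
        have near: "card (M \<inter> l1_ball (x - 2) y (r - 2)) \<le> 1"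
          "r - 2 < d \<Longrightarrow> card (M \<inter> l1_ball (x - 2) y (r - 2)) = 0"
          using robust_packing_near[OF R, of "r - 2" "x - 2" y] F Hy unfolding d_def by auto
        have "2 + j \<le> r" "r - 2 = d \<Longrightarrow> 3 + j \<le> r"
          using False F j 3 x y WH H5 \<open>0 \<le> j\<close> unfolding d by linarith+
        then show ?thesis using split k le near F by fastforce
      qed
    qed
  qed
qed

definition flop :: "int \<Rightarrow> int \<times> int \<Rightarrow> int \<times> int" where
  "flop H = (\<lambda>(p, q). (p, H - q))"

lemma flop_conv: "flop H ` M = prod.swap ` flip H ` prod.swap ` M"
  unfolding image_image by (rule image_cong) (auto simp: flop_def flip_def)

lemma card_flop: "card (flop H ` M \<inter> l1_ball x y r) = card (M \<inter> l1_ball x (H - y) r)"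
  unfolding flop_conv card_swap card_flip ..

text \<open>The bare triangles reach back at most \<open>(H + 1) / 2 \<le> 3\<close> columns from
  the end. After adding four columns they meet no old point, so the move can be repeated.\<close>

lemma robust_packing_extend:
  assumes R: "robust_packing W H M" and E: "bare_end W H M" and H: "H = 3 \<or> H = 5" "H \<le> W"
  shows "robust_packing (W + 4) H (extend W H M)" "bare_end (W + 4) H (extend W H M)"
proof -
  have box: "M \<subseteq> {0..W} \<times> {0..H}" and WH: "3 \<le> W" "3 \<le> H" "odd W" "odd H"
    and size: "2 * int (card M) = W + H + 2"
    using R unfolding robust_packing_def by auto
  show "bare_end (W + 4) H (extend W H M)"
    using H box unfolding bare_end_def extend_def by fastforce
  show "robust_packing (W + 4) H (extend W H M)"
    unfolding robust_packing_def
  proof (intro conjI allI impI)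
    show "3 \<le> W + 4" "3 \<le> H" "odd (W + 4)" "odd H"
      "extend W H M \<subseteq> {0..W + 4} \<times> {0..H}"
      "2 * int (card (extend W H M)) = W + 4 + H + 2"
      using WH size box card_extend[OF box] by (auto simp: extend_def)
    fix x y r j :: int
    assume *: "0 \<le> x" "x \<le> W + 4" "0 \<le> y" "y \<le> H" "1 \<le> r" "0 \<le> j"
      and j: "j = 0 \<or> min x (W + 4 - x) + min y (H - y) + 4 * j \<le> r"
    show "int (card (extend W H M \<inter> l1_ball x y r)) + j \<le> r"
    proof (cases "2 * y \<le> H")
      case True
      then have "j = 0 \<or> x + y + 4 * j \<le> r \<or> W + 4 - x + y + 4 * j \<le> r" using j by auto
      with True * show ?thesis using extend_card_aux[OF R E H] by blast
    next
      case False
      have R': "robust_packing W H (flop H ` M)"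
        unfolding flop_conv by (intro robust_packing_swap robust_packing_flip R)
      have E': "bare_end W H (flop H ` M)"
        using E unfolding bare_end_def flop_def by fastforce
      have "j = 0 \<or> x + (H - y) + 4 * j \<le> r \<or> W + 4 - x + (H - y) + 4 * j \<le> r"
        using j False by auto
      then have "int (card (extend W H (flop H ` M) \<inter> l1_ball x (H - y) r)) + j \<le> r"
        using extend_card_aux[OF R' E' H] False * by auto
      moreover have "extend W H (flop H ` M) = flop H ` extend W H M"
        by (auto simp: extend_def flop_def)
      ultimately show ?thesis by (simp add: card_flop)
    qed
  qed
qed


section \<open>Existence of robust packings\<close>

text \<open>At each centre and radius the largest admissible slack is tested. Radii stop at
  \<open>W + H\<close>, the largest distance in the box.\<close>

definition robust_check :: "int \<Rightarrow> int \<Rightarrow> (int \<times> int) list \<Rightarrow> bool" where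
  "robust_check W H ms \<longleftrightarrow>
     list_all (\<lambda>x. list_all (\<lambda>y. list_all (\<lambda>r.
       int (length (filter (\<lambda>(p, q). \<bar>p - x\<bar> + \<bar>q - y\<bar> \<le> r) ms))
         + max 0 ((r - min x (W - x) - min y (H - y)) div 4) \<le> r)
       [1..W + H]) [0..H]) [0..W]"

text \<open>Beyond the radii tested, the slack is at most \<open>r / 4\<close>, and
  \<open>len\<close> bounds the number of points by three quarters of
  \<open>W + H + 1 \<le> r\<close>.\<close>

lemma robust_checkD:
  assumes "robust_check W H ms" "distinct ms" and len: "4 * int (length ms) \<le> 3 * W + 3 * H + 3"
    and xy: "0 \<le> x" "x \<le> W" "0 \<le> y" "y \<le> H" and rj: "1 \<le> r" "0 \<le> j"
    and j: "j = 0 \<or> min x (W - x) + min y (H - y) + 4 * j \<le> r"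
  shows "int (card (set ms \<inter> l1_ball x y r)) + j \<le> r"
proof -
  have eq: "set ms \<inter> l1_ball x y r = set (filter (\<lambda>(p, q). \<bar>p - x\<bar> + \<bar>q - y\<bar> \<le> r) ms)"
    by (auto simp: l1_ball_def)
  have card: "card (set ms \<inter> l1_ball x y r) = length (filter (\<lambda>(p, q). \<bar>p - x\<bar> + \<bar>q - y\<bar> \<le> r) ms)"
    unfolding eq by (rule distinct_card) (simp add: assms(2))
  define m where "m = min x (W - x) + min y (H - y)"
  have "0 \<le> m" using xy unfolding m_def by auto
  show ?thesis
  proof (cases "r \<le> W + H")
    case True
    have "int (length (filter (\<lambda>(p, q). \<bar>p - x\<bar> + \<bar>q - y\<bar> \<le> r) ms)) + max 0 ((r - m) div 4) \<le> r"
      using assms(1) xy rj True unfolding robust_check_def list_all_iff m_def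
      by (simp add: diff_diff_eq)
    moreover have "j \<le> max 0 ((r - m) div 4)"
      using j unfolding m_def[symmetric] by linarith
    ultimately show ?thesis unfolding card by linarith
  next
    case False
    have "int (card (set ms \<inter> l1_ball x y r)) \<le> int (length ms)"
      unfolding card by simp
    moreover have "W + H + 1 \<le> r" using False by simp
    moreover have "4 * j \<le> r" using j \<open>0 \<le> m\<close> \<open>1 \<le> r\<close> unfolding m_def[symmetric] by linarith
    ultimately show ?thesis using len by linarith
  qed
qed

lemma robust_packing_check:
  assumes "robust_check W H ms" "distinct ms" "set ms \<subseteq> {0..W} \<times> {0..H}"
    and "odd W" "odd H" "3 \<le> W" "3 \<le> H" and "2 * int (length ms) = W + H + 2"
  shows "robust_packing W H (set ms)"
  unfolding robust_packing_def
proof (intro conjI allI impI)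
  show "2 * int (card (set ms)) = W + H + 2"
    using assms by (simp add: distinct_card)
qed (use assms in \<open>auto intro!: robust_checkD\<close>)

text \<open>The starting configurations were found by computer search.\<close>

lemma robust_packing_4_4:
  "\<exists>M. robust_packing 3 3 M \<and> bare_end 3 3 M"
proof -
  let ?ms = "[(0, 0), (3, 0), (0, 3), (3, 3)]"
  have "robust_packing 3 3 (set ?ms)" by (rule robust_packing_check) (code_simp, auto)
  moreover have "bare_end 3 3 (set ?ms)" by (simp add: bare_end_def)
  ultimately show ?thesis by blast
qed

text \<open>Starts the family of height 4 whose width is 2 modulo 4. Width 6 is the exceptional
  grid, which has no packing of the required size 5.\<close>

lemma robust_packing_10_4:
  "\<exists>M. robust_packing 9 3 M \<and> bare_end 9 3 M"
proof -
  let ?ms = "[(0, 0), (9, 0), (0, 3), (9, 3), (3, 0), (4, 3), (6, 0)]"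
  have "robust_packing 9 3 (set ?ms)" by (rule robust_packing_check) (code_simp, auto)
  moreover have "bare_end 9 3 (set ?ms)" by (simp add: bare_end_def)
  ultimately show ?thesis by blast
qed

lemma robust_packing_6_6:
  "\<exists>M. robust_packing 5 5 M \<and> bare_end 5 5 M"
proof -
  let ?ms = "[(0, 0), (5, 0), (0, 5), (5, 5), (2, 1), (2, 4)]"
  have "robust_packing 5 5 (set ?ms)" by (rule robust_packing_check) (code_simp, auto)
  moreover have "bare_end 5 5 (set ?ms)" by (simp add: bare_end_def)
  ultimately show ?thesis by blast
qed

lemma robust_packing_8_6:
  "\<exists>M. robust_packing 7 5 M \<and> bare_end 7 5 M"
proof -
  let ?ms = "[(0, 0), (7, 0), (0, 5), (7, 5), (1, 2), (3, 5), (4, 1)]"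
  have "robust_packing 7 5 (set ?ms)" by (rule robust_packing_check) (code_simp, auto)
  moreover have "bare_end 7 5 (set ?ms)" by (simp add: bare_end_def)
  ultimately show ?thesis by blast
qed

text \<open>This box would arise by framing the exceptional one, so it gets its own configuration.
  It is only framed, never lengthened, hence no \<open>bare_end\<close>.\<close>

lemma robust_packing_10_8:
  "\<exists>M. robust_packing 9 7 M"
proof -
  let ?ms = "[(0, 0), (9, 0), (0, 7), (9, 7), (0, 3), (2, 4), (3, 0), (3, 7), (9, 3)]"
  have "robust_packing 9 7 (set ?ms)" by (rule robust_packing_check) (code_simp, auto)
  then show ?thesis by blast
qed

section \<open>Iterating the two moves\<close>

lemma robust_packing_extend_iterate:
  assumes "robust_packing W H M" "bare_end W H M" "H = 3 \<or> H = 5" "H \<le> W"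
  shows "\<exists>M. robust_packing (W + 4 * int k) H M \<and> bare_end (W + 4 * int k) H M"
proof (induction k)
  case 0
  then show ?case using assms by auto
next
  case (Suc k)
  then obtain M where "robust_packing (W + 4 * int k) H M" "bare_end (W + 4 * int k) H M" by blast
  from robust_packing_extend[OF this assms(3)] assms(4)
  show ?case by (auto simp: algebra_simps)
qed

lemma robust_packing_frame_iterate:
  "robust_packing W H M \<Longrightarrow> \<exists>M. robust_packing (W + 4 * int k) (H + 4 * int k) M"
proof (induction k)
  case (Suc k)
  then obtain M where "robust_packing (W + 4 * int k) (H + 4 * int k) M" by blast
  from robust_packing_frame[OF this] show ?case by (auto simp: algebra_simps)
qed auto

text \<open>For each height the odd \<open>W\<close> form two classes modulo 4, each grown from its
  smallest box; only for \<open>H = 3\<close> and \<open>W\<close> congruent to 1 does the family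
  start at 9 instead of the exceptional 5.\<close>

lemma robust_packing_strip:
  assumes "odd W" "H = 3 \<or> H = 5" "H \<le> W" "(W, H) \<noteq> (5, 3)"
  shows "\<exists>M. robust_packing W H M"
proof -
  have ext: "\<exists>M. robust_packing W H M"
    if "\<exists>N. robust_packing V H N \<and> bare_end V H N" "V \<le> W" "4 dvd W - V" "H \<le> V" for V
  proof -
    have "W = V + 4 * int (nat ((W - V) div 4))" using that by auto
    then show ?thesis
      using that(1,4) assms(2) robust_packing_extend_iterate by metis
  qed
  consider "H = 3" "4 dvd W - 3" | "H = 3" "9 \<le> W" "4 dvd W - 9" | "H = 5" "4 dvd W - 5"
    | "H = 5" "7 \<le> W" "4 dvd W - 7"
  proof -
    assume th: "\<lbrakk>H = 3; 4 dvd W - 3\<rbrakk> \<Longrightarrow> thesis" "\<lbrakk>H = 3; 9 \<le> W; 4 dvd W - 9\<rbrakk> \<Longrightarrow> thesis"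
      "\<lbrakk>H = 5; 4 dvd W - 5\<rbrakk> \<Longrightarrow> thesis" "\<lbrakk>H = 5; 7 \<le> W; 4 dvd W - 7\<rbrakk> \<Longrightarrow> thesis"
    have "4 dvd W - 3 \<or> 4 dvd W - 9" "4 dvd W - 5 \<or> 4 dvd W - 7"
      "4 dvd W - 9 \<Longrightarrow> 3 \<le> W \<Longrightarrow> W = 5 \<or> 9 \<le> W" "4 dvd W - 7 \<Longrightarrow> 5 \<le> W \<Longrightarrow> 7 \<le> W"
      using assms(1) by presburger+
    then show thesis using th assms(2-4) by blast
  qed
  then show ?thesis
  proof cases
    case 1 with assms(3) robust_packing_4_4 show ?thesis by (intro ext[of 3]) auto
  next
    case 2 with robust_packing_10_4 show ?thesis by (intro ext[of 9]) auto
  next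
    case 3 with assms(3) robust_packing_6_6 show ?thesis by (intro ext[of 5]) auto
  next
    case 4 with robust_packing_8_6 show ?thesis by (intro ext[of 7]) auto
  qed
qed

lemma robust_packing_exists_wide:
  assumes "odd W" "odd H" "3 \<le> H" "H \<le> W" "(W, H) \<noteq> (5, 3)"
  shows "\<exists>M. robust_packing W H M"
proof -
  \<comment> \<open>Peeling off \<open>k\<close> frames leaves a strip of height \<open>h\<close>,
    which is 3 or 5.\<close>
  define h where "h = 3 + (H - 3) mod 4"
  define k where "k = nat ((H - 3) div 4)"
  have Hk: "H = h + 4 * int k" using assms(3) unfolding h_def k_def by (simp add: pos_imp_zdiv_nonneg_iff)
  have h: "h = 3 \<or> h = 5" using assms(2,3) unfolding h_def by presburger
  show ?thesis
  proof (cases "(W - 4 * int k, h) = (5, 3)")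
    case True
    \<comment> \<open>All \<open>k\<close> frames would leave the exceptional box, so one fewer is
      removed; \<open>k\<close> is positive because \<open>(W, H) \<noteq> (5, 3)\<close>.\<close>
    then have "W = 9 + 4 * int (k - 1)" "H = 7 + 4 * int (k - 1)" using Hk assms(5) by auto
    then show ?thesis using robust_packing_10_8 robust_packing_frame_iterate by metis
  next
    case False
    have "\<exists>M. robust_packing (W - 4 * int k) h M"
      by (rule robust_packing_strip) (use False h assms Hk in auto)
    then obtain M where "robust_packing (W - 4 * int k) h M" by blast
    from robust_packing_frame_iterate[OF this, of k] show ?thesis using Hk by simp
  qed
qed

lemma robust_packing_exists:
  assumes "odd W" "odd H" "3 \<le> W" "3 \<le> H" "(W, H) \<noteq> (5, 3)" "(W, H) \<noteq> (3, 5)"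
  shows "\<exists>M. robust_packing W H M"
proof (cases "H \<le> W")
  case True
  then show ?thesis using assms by (intro robust_packing_exists_wide) auto
next
  case False
  have "\<exists>M. robust_packing H W M" by (rule robust_packing_exists_wide) (use False assms in auto)
  then show ?thesis using robust_packing_swap by blast
qed

section \<open>Distances, broadcasts and multipackings in grids\<close>

lemma graph_dist_le:
  assumes "wf_digraph G" "pre_digraph.awalk G u p v"
  shows "graph_dist G u v \<le> ereal (real (length p))"
proof -
  interpret wf_digraph G by fact
  have "awalk_cost (\<lambda>_. 1) p = real (length p)"
    by (induction p) auto
  then show ?thesis
    using min_cost_le_walk_cost[OF assms(2), of "\<lambda>_. 1"] by (simp add: graph_dist_def)
qed

lemma le_graph_dist:
  assumes "wf_digraph G" "\<And>p. pre_digraph.awalk G u p v \<Longrightarrow> k \<le> length p"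
  shows "ereal (real k) \<le> graph_dist G u v"
proof -
  interpret wf_digraph G by fact
  have "awalk_cost (\<lambda>_. 1) p = real (length p)" for p :: "'b list"
    by (induction p) auto
  then show ?thesis
    unfolding graph_dist_def \<mu>_def using assms(2) by (intro INF_greatest) auto
qed

abbreviation grid :: "nat \<Rightarrow> nat \<Rightarrow> (nat \<times> nat) pair_pre_digraph" where
  "grid n m \<equiv> path_graph n \<box> path_graph m"

lemma pverts_grid: "pverts (grid n m) = {..<n} \<times> {..<m}"
  by (simp add: cart_prod_def path_graph_def)

lemma parcs_grid: "parcs (grid n m) = {((a, b), (c, d)). a < n \<and> c < n \<and> b < m \<and> d < m \<and>
    ((a = c \<and> (d = Suc b \<or> b = Suc d)) \<or> (b = d \<and> (c = Suc a \<or> a = Suc c)))}"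
  by (auto simp: cart_prod_def path_graph_def)

definition l1_dist :: "nat \<times> nat \<Rightarrow> nat \<times> nat \<Rightarrow> int" where
  "l1_dist u v = \<bar>int (fst u) - int (fst v)\<bar> + \<bar>int (snd u) - int (snd v)\<bar>"

lemma wf_grid: "wf_digraph (grid n m)"
proof -
  interpret pair_graph "grid n m" by (intro pair_graph_cart_prod pair_graph_path_graph)
  show ?thesis by unfold_locales
qed

lemma grid_neighbour:
  assumes "u \<in> pverts (grid n m)" "v \<in> pverts (grid n m)" "u \<noteq> v"
  shows "\<exists>w. (u, w) \<in> parcs (grid n m) \<and> l1_dist w v = l1_dist u v - 1"
proof -
  obtain a b c d where uv [simp]: "u = (a, b)" "v = (c, d)" by (cases u, cases v)
  have *: "a < n" "b < m" "c < n" "d < m" using assms by (auto simp: pverts_grid)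
  consider "a < c" | "c < a" | "a = c" "b < d" | "a = c" "d < b" using assms(3) by force
  then show ?thesis
  proof cases
    case 1 with * show ?thesis by (intro exI[of _ "(a + 1, b)"]) (simp add: parcs_grid l1_dist_def)
  next
    case 2 with * show ?thesis by (intro exI[of _ "(a - 1, b)"]) (simp add: parcs_grid l1_dist_def)
  next
    case 3 with * show ?thesis by (intro exI[of _ "(a, b + 1)"]) (simp add: parcs_grid l1_dist_def)
  next
    case 4 with * show ?thesis by (intro exI[of _ "(a, b - 1)"]) (simp add: parcs_grid l1_dist_def)
  qed
qed

text \<open>An arc changes one coordinate by one, so no walk is shorter than the l1 distance; always
  stepping to a closer neighbour attains it.\<close>

lemma grid_dist:
  assumes "u \<in> pverts (grid n m)" "v \<in> pverts (grid n m)"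
  shows "graph_dist (grid n m) u v = ereal (of_int (l1_dist u v))"
proof (rule antisym)
  interpret wf_digraph "grid n m" by (rule wf_grid)
  have "l1_dist u v \<le> int (length p)" if "awalk u p v" for p
    using that
  proof (induction p arbitrary: u)
    case Nil
    then show ?case by (simp add: awalk_Nil_iff l1_dist_def)
  next
    case (Cons e p)
    then have "e \<in> parcs (grid n m)" "u = fst e" "l1_dist (snd e) v \<le> int (length p)"
      by (auto simp: awalk_Cons_iff)
    then show ?case by (auto simp: parcs_grid l1_dist_def)
  qed
  then have "ereal (real (nat (l1_dist u v))) \<le> graph_dist (grid n m) u v"
    by (intro le_graph_dist[OF wf_grid]) (simp add: nat_le_iff)
  then show "ereal (of_int (l1_dist u v)) \<le> graph_dist (grid n m) u v"
    by (simp add: l1_dist_def)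
  have "\<exists>p. awalk u p v \<and> int (length p) = l1_dist u v"
    using assms
  proof (induction "nat (l1_dist u v)" arbitrary: u)
    case 0
    then have "l1_dist u v \<le> 0" by simp
    then have "fst u = fst v" "snd u = snd v" unfolding l1_dist_def by linarith+
    then have "u = v" by (rule prod_eqI)
    then show ?case using 0 by (intro exI[of _ "[]"]) (simp add: awalk_Nil_iff l1_dist_def)
  next
    case (Suc k)
    then have "u \<noteq> v" by (auto simp: l1_dist_def)
    with Suc grid_neighbour obtain w
      where w: "(u, w) \<in> parcs (grid n m)" "l1_dist w v = l1_dist u v - 1" by meson
    moreover have "w \<in> pverts (grid n m)" using w(1) by (auto simp: parcs_grid pverts_grid)
    moreover have "k = nat (l1_dist w v)" using Suc(2) w(2) by linarith
    ultimately obtain p where "awalk w p v" "int (length p) = l1_dist w v"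
      using Suc(1)[of w] Suc(4) by blast
    then show ?case
      using w by (intro exI[of _ "(u, w) # p"]) (simp add: awalk_Cons_iff)
  qed
  then show "graph_dist (grid n m) u v \<le> ereal (of_int (l1_dist u v))"
    using graph_dist_le[OF wf_grid] by (metis of_int_of_nat_eq)
qed

lemma grid_ball:
  assumes "v \<in> pverts (grid n m)"
  shows "graph_ball (grid n m) r v = {u \<in> pverts (grid n m). l1_dist u v \<le> int r}"
proof -
  have "graph_dist (grid n m) u v \<le> ereal (real r) \<longleftrightarrow> l1_dist u v \<le> int r"
    if "u \<in> pverts (grid n m)" for u
    unfolding grid_dist[OF that assms] by (metis ereal_less_eq(3) of_int_le_iff of_int_of_nat_eq)
  then show ?thesis unfolding graph_ball_def with_proj_simps by blast
qed

section \<open>Weak duality and the evaluation of the two numbers\<close>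

text \<open>
  Weak duality for fractional multipackings: the multiplicity of a vertex in the list, divided by
  \<open>K\<close>, is its weight.
\<close>

lemma broadcast_cost_ge:
  assumes "finite (verts G)" "dominating_broadcast G f" "set ps \<subseteq> verts G"
    and ball: "\<And>v r. v \<in> verts G \<Longrightarrow> 0 < r \<Longrightarrow> length (filter (\<lambda>u. u \<in> graph_ball G r v) ps) \<le> K * r"
  shows "length ps \<le> K * broadcast_cost G f"
proof -
  define D where "D = {v \<in> verts G. 0 < f v}"
  have "finite D" using assms(1) by (simp add: D_def)
  have "length ps \<le> (\<Sum>v\<in>D. length (filter (\<lambda>u. u \<in> graph_ball G (f v) v) ps))"
    using assms(3)
  proof (induction ps)
    case (Cons u ps)
    then obtain v where v: "v \<in> D" "u \<in> graph_ball G (f v) v"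
      using assms(2) by (auto simp: dominating_broadcast_def D_def graph_ball_def)
    \<comment> \<open>The new entry \<open>u\<close> is counted at least by the ball around
      \<open>v\<close>.\<close>
    have "(\<Sum>v\<in>D. length (filter (\<lambda>u. u \<in> graph_ball G (f v) v) ps))
        < (\<Sum>v\<in>D. length (filter (\<lambda>u. u \<in> graph_ball G (f v) v) (u # ps)))"
      by (rule sum_strict_mono_ex1) (use \<open>finite D\<close> v in auto)
    then show ?case using Cons by simp
  qed simp
  also have "\<dots> \<le> (\<Sum>v\<in>D. K * f v)"
    by (rule sum_mono) (auto simp: D_def intro: ball)
  also have "\<dots> = K * (\<Sum>v\<in>D. f v)" by (simp add: sum_distrib_left)
  also have "(\<Sum>v\<in>D. f v) = broadcast_cost G f"
    unfolding broadcast_cost_def D_def using assms(1) by (intro sum.mono_neutral_left) auto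
  finally show ?thesis .
qed

lemma multipacking_card_le:
  assumes "finite (verts G)" "multipacking G M" "dominating_broadcast G f"
  shows "card M \<le> broadcast_cost G f"
proof -
  have M: "M \<subseteq> verts G" "finite M"
    using assms finite_subset by (auto simp: multipacking_def)
  obtain ps where ps: "set ps = M" "distinct ps" using finite_distinct_list[OF M(2)] by blast
  have "length ps \<le> 1 * broadcast_cost G f"
  proof (rule broadcast_cost_ge[OF assms(1,3)])
    fix v r assume "v \<in> verts G" "0 < (r :: nat)"
    then have "card (graph_ball G r v \<inter> M) \<le> r" using assms(2) by (simp add: multipacking_def)
    moreover have "set (filter (\<lambda>u. u \<in> graph_ball G r v) ps) = graph_ball G r v \<inter> M"
      using ps(1) by auto
    moreover have "length (filter (\<lambda>u. u \<in> graph_ball G r v) ps)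
        = card (set (filter (\<lambda>u. u \<in> graph_ball G r v) ps))"
      by (rule distinct_card[symmetric]) (simp add: ps(2))
    ultimately show "length (filter (\<lambda>u. u \<in> graph_ball G r v) ps) \<le> 1 * r" by simp
  qed (use ps M in auto)
  then show ?thesis using distinct_card[OF ps(2)] ps(1) by simp
qed

lemma multipacking_number_eqI:
  assumes "finite (verts G)" "multipacking G M" "card M = k" "\<And>N. multipacking G N \<Longrightarrow> card N \<le> k"
  shows "multipacking_number G = k"
  unfolding multipacking_number_def
proof (rule Max_eqI)
  have "{card M |M. multipacking G M} \<subseteq> card ` Pow (verts G)" by (auto simp: multipacking_def)
  then show "finite {card M |M. multipacking G M}" using assms(1) finite_subset by blast
qed (use assms in auto)

lemma broadcast_number_eqI:
  assumes "dominating_broadcast G f" "broadcast_cost G f = k"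
    and "\<And>g. dominating_broadcast G g \<Longrightarrow> k \<le> broadcast_cost G g"
  shows "broadcast_number G = k"
  unfolding broadcast_number_def by (rule Least_equality) (use assms in auto)

lemma finite_grid: "finite (verts (grid n m))"
  by (simp add: pverts_grid)

lemma grid_radius_broadcast:
  assumes "2 \<le> n" "2 \<le> m"
  defines "f \<equiv> (\<lambda>v. if v = (n div 2, m div 2) then n div 2 + m div 2 else 0)"
  shows "dominating_broadcast (grid n m) f" "broadcast_cost (grid n m) f = n div 2 + m div 2"
proof -
  have c: "(n div 2, m div 2) \<in> pverts (grid n m)" using assms by (auto simp: pverts_grid)
  show "dominating_broadcast (grid n m) f"
    unfolding dominating_broadcast_def
  proof
    fix u assume u: "u \<in> verts (grid n m)"
    \<comment> \<open>The ends of \<open>0..n - 1\<close> are at distances \<open>n div 2\<close>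
      and \<open>n - 1 - n div 2 \<le> n div 2\<close> from \<open>n div 2\<close>.\<close>
    have "l1_dist u (n div 2, m div 2) \<le> int (n div 2 + m div 2)"
      using u assms by (auto simp: pverts_grid l1_dist_def)
    then have "ereal (of_int (l1_dist u (n div 2, m div 2))) \<le> ereal (real (n div 2 + m div 2))"
      by (metis ereal_less_eq(3) of_int_le_iff of_int_of_nat_eq)
    then show "\<exists>v\<in>verts (grid n m). 0 < f v \<and> graph_dist (grid n m) u v \<le> ereal (real (f v))"
      using u c assms by (intro bexI[of _ "(n div 2, m div 2)"]) (auto simp: grid_dist f_def)
  qed
  show "broadcast_cost (grid n m) f = n div 2 + m div 2"
    unfolding broadcast_cost_def f_def using c finite_grid by simp
qed

section \<open>Packings of the right size\<close>

text \<open>Multipackings in integer coordinates. Parity and size are left open, to admit odd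
  numbers of vertices and the small special grids.\<close>

definition box_packing :: "int \<Rightarrow> int \<Rightarrow> (int \<times> int) set \<Rightarrow> bool" where
  "box_packing W H M \<longleftrightarrow> M \<subseteq> {0..W} \<times> {0..H} \<and>
     (\<forall>x y r. 0 \<le> x \<longrightarrow> x \<le> W \<longrightarrow> 0 \<le> y \<longrightarrow> y \<le> H \<longrightarrow> 1 \<le> r \<longrightarrow> int (card (M \<inter> l1_ball x y r)) \<le> r)"

lemma box_packingD:
  assumes "box_packing W H M" "0 \<le> x" "x \<le> W" "0 \<le> y" "y \<le> H" "1 \<le> r"
  shows "int (card (M \<inter> l1_ball x y r)) \<le> r"
  using assms by (simp add: box_packing_def)

lemma box_packing_swap: "box_packing W H M \<Longrightarrow> box_packing H W (prod.swap ` M)"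
  unfolding box_packing_def card_swap by auto

text \<open>The robust bound holds for every centre of the plane, so the box may grow around an
  unchanged packing.\<close>

lemma robust_packing_box:
  assumes "robust_packing W H M" "W \<le> W'" "H \<le> H'"
  shows "box_packing W' H' M"
  using robust_packing_bound[OF assms(1), of 0] assms unfolding box_packing_def robust_packing_def
  by fastforce

lemma inj_map_prod_int: "inj (map_prod int int)"
  by (auto simp: inj_def)

lemma multipacking_grid_iff:
  "multipacking (grid n m) M \<longleftrightarrow> box_packing (int n - 1) (int m - 1) (map_prod int int ` M)"
proof -
  have card: "card (map_prod int int ` M \<inter> l1_ball (int x) (int y) (int r))
      = card (graph_ball (grid n m) r (x, y) \<inter> M)"
    if "M \<subseteq> verts (grid n m)" "(x, y) \<in> pverts (grid n m)" for x y r
  proof -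
    have "graph_ball (grid n m) r (x, y) \<inter> M = M \<inter> {u. l1_dist u (x, y) \<le> int r}"
      using that by (auto simp: grid_ball)
    moreover have "card (map_prod int int ` M \<inter> l1_ball (int x) (int y) (int r))
        = card (M \<inter> {u. l1_dist u (x, y) \<le> int r})"
      by (rule card_image_Int[OF refl inj_map_prod_int]) (auto simp: l1_ball_def l1_dist_def)
    ultimately show ?thesis by simp
  qed
  have sub: "map_prod int int ` M \<subseteq> {0..int n - 1} \<times> {0..int m - 1} \<longleftrightarrow> M \<subseteq> verts (grid n m)"
    by (force simp: image_subset_iff pverts_grid)
  show ?thesis
  proof
    assume M: "multipacking (grid n m) M"
    show "box_packing (int n - 1) (int m - 1) (map_prod int int ` M)"
      unfolding box_packing_def sub
    proof (intro conjI allI impI)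
      show V: "M \<subseteq> verts (grid n m)" using M by (simp add: multipacking_def)
      fix x y r :: int
      assume *: "0 \<le> x" "x \<le> int n - 1" "0 \<le> y" "y \<le> int m - 1" "1 \<le> r"
      then have "(nat x, nat y) \<in> pverts (grid n m)" by (auto simp: pverts_grid)
      moreover from this M * have "card (graph_ball (grid n m) (nat r) (nat x, nat y) \<inter> M) \<le> nat r"
        by (simp add: multipacking_def)
      ultimately show "int (card (map_prod int int ` M \<inter> l1_ball x y r)) \<le> r"
        using card[OF V, of "nat x" "nat y" "nat r"] * by (simp add: le_nat_iff)
    qed
  next
    assume B: "box_packing (int n - 1) (int m - 1) (map_prod int int ` M)"
    then have V: "M \<subseteq> verts (grid n m)" by (simp add: box_packing_def sub)
    have "card (graph_ball (grid n m) r v \<inter> M) \<le> r" if "v \<in> verts (grid n m)" "0 < r" for v r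
    proof (cases v)
      case (Pair x y)
      then have "int (card (map_prod int int ` M \<inter> l1_ball (int x) (int y) (int r))) \<le> int r"
        using that by (intro box_packingD[OF B]) (auto simp: pverts_grid)
      then show ?thesis using card[OF V, of x y r] that Pair by simp
    qed
    with V show "multipacking (grid n m) M" by (simp add: multipacking_def)
  qed
qed

text \<open>The packing is as large as the cost of the one-vertex broadcast, so weak duality makes
  both optimal.\<close>

lemma grid_numbers_eq_radius:
  assumes "2 \<le> n" "2 \<le> m" "box_packing (int n - 1) (int m - 1) B" "card B = n div 2 + m div 2"
  shows "multipacking_number (grid n m) = n div 2 + m div 2"
    and "broadcast_number (grid n m) = n div 2 + m div 2"
proof -
  define M where "M = map_prod nat nat ` B"
  have "map_prod int int ` M = (\<lambda>z. z) ` B"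
    unfolding M_def image_image using assms(3) by (intro image_cong) (auto simp: box_packing_def)
  then have M: "multipacking (grid n m) M" "card M = n div 2 + m div 2"
    using assms(3,4) multipacking_grid_iff card_image[OF inj_on_subset[OF inj_map_prod_int], of M] by auto
  note f = grid_radius_broadcast[OF assms(1,2)]
  show "multipacking_number (grid n m) = n div 2 + m div 2"
    using multipacking_card_le[OF finite_grid _ f(1)] f(2) M
    by (intro multipacking_number_eqI[OF finite_grid]) auto
  show "broadcast_number (grid n m) = n div 2 + m div 2"
    using multipacking_card_le[OF finite_grid M(1)] f M(2)
    by (intro broadcast_number_eqI) auto
qed

lemma box_packing_check:
  assumes "robust_check W H ms" "distinct ms" "4 * int (length ms) \<le> 3 * W + 3 * H + 3"
    "set ms \<subseteq> {0..W} \<times> {0..H}"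
  shows "box_packing W H (set ms)"
  using robust_checkD[OF assms(1-3), of _ _ _ 0] assms(4) by (auto simp: box_packing_def)

lemma box_packing_mono:
  assumes "box_packing W H M" "W' \<le> W" "H' \<le> H" "M \<subseteq> {0..W'} \<times> {0..H'}"
  shows "box_packing W' H' M"
  using assms unfolding box_packing_def by auto

text \<open>The boxes whose even part is the exceptional one. The first configuration stays in
  columns 0 to 3 and so serves both widths.\<close>

lemma box_packing_exceptional:
  assumes "W = 3 \<or> W = 4" "H = 5 \<or> H = 6" "(W, H) \<noteq> (3, 5)"
  shows "\<exists>B. box_packing W H B \<and> card B = 5"
proof (cases "H = 6")
  case True
  let ?ms = "[(0, 0), (0, 3), (0, 6), (3, 0), (3, 4)] :: (int \<times> int) list"
  have "box_packing 4 6 (set ?ms)" by (rule box_packing_check) (code_simp, auto)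
  then have "box_packing W H (set ?ms)" by (rule box_packing_mono) (use True assms in auto)
  then show ?thesis by (intro exI[of _ "set ?ms"]) simp
next
  case False
  let ?ms = "[(0, 0), (0, 3), (1, 5), (3, 0), (4, 5)] :: (int \<times> int) list"
  have "box_packing 4 5 (set ?ms)" by (rule box_packing_check) (code_simp, auto)
  then show ?thesis using False assms by (intro exI[of _ "set ?ms"]) auto
qed

lemma box_packing_exists:
  assumes "4 \<le> n" "4 \<le> m" "(n, m) \<noteq> (4, 6)" "(n, m) \<noteq> (6, 4)"
  shows "\<exists>B. box_packing (int n - 1) (int m - 1) B \<and> card B = n div 2 + m div 2"
proof -
  \<comment> \<open>Rounding down to even numbers of vertices keeps the halves, so
    \<open>(W + H + 2) / 2\<close> is exactly \<open>n div 2 + m div 2\<close>.\<close>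
  define W H where "W = 2 * int (n div 2) - 1" and "H = 2 * int (m div 2) - 1"
  have WH: "odd W" "odd H" "3 \<le> W" "3 \<le> H" "W \<le> int n - 1" "H \<le> int m - 1"
  proof -
    have "2 \<le> n div 2" "2 \<le> m div 2" using assms(1,2) by presburger+
    then show "odd W" "odd H" "3 \<le> W" "3 \<le> H" "W \<le> int n - 1" "H \<le> int m - 1"
      unfolding W_def H_def by auto
  qed
  consider "(W, H) = (3, 5)" | "(W, H) = (5, 3)" | "(W, H) \<noteq> (3, 5)" "(W, H) \<noteq> (5, 3)" by blast
  then show ?thesis
  proof cases
    case 1
    then have "n div 2 = 2" "m div 2 = 3" by (auto simp: W_def H_def)
    then have "n = 4 \<or> n = 5" "m = 6 \<or> m = 7" by presburger+
    then have "\<exists>B. box_packing (int n - 1) (int m - 1) B \<and> card B = 5"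
      using assms(3) by (intro box_packing_exceptional) auto
    then show ?thesis using \<open>n div 2 = 2\<close> \<open>m div 2 = 3\<close> by simp
  next
    case 2
    then have "n div 2 = 3" "m div 2 = 2" by (auto simp: W_def H_def)
    then have "n = 6 \<or> n = 7" "m = 4 \<or> m = 5" by presburger+
    then have "\<exists>B. box_packing (int m - 1) (int n - 1) B \<and> card B = 5"
      using assms(4) by (intro box_packing_exceptional) auto
    then obtain B where "box_packing (int m - 1) (int n - 1) B" "card B = 5" by blast
    then have "box_packing (int n - 1) (int m - 1) (prod.swap ` B)" "card (prod.swap ` B) = 5"
      using box_packing_swap by (auto simp: card_image)
    then show ?thesis using \<open>n div 2 = 3\<close> \<open>m div 2 = 2\<close> by auto
  next
    case 3
    obtain M where M: "robust_packing W H M" using robust_packing_exists[OF WH(1-4)] 3 by blast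
    then have "2 * int (card M) = W + H + 2" by (simp add: robust_packing_def)
    then have "card M = n div 2 + m div 2" by (simp add: W_def H_def)
    then show ?thesis using robust_packing_box[OF M WH(5,6)] by blast
  qed
qed

section \<open>The exceptional grid\<close>

lemma box_packing_4_6_card_le:
  assumes B: "box_packing 3 5 M"
  shows "card M \<le> 4"
proof (rule ccontr)
  assume big: "\<not> card M \<le> 4"
  have box: "M \<subseteq> {0..3} \<times> {0..5}" using B by (simp add: box_packing_def)
  then have fin: "finite M" using finite_subset by blast
  have ball: "int (card (M \<inter> l1_ball x y r)) \<le> r"
    if "0 \<le> x" "x \<le> 3" "0 \<le> y" "y \<le> 5" "1 \<le> r" for x y r
    using B that by (simp add: box_packing_def)
  txt \<open>Each of the four central vertices is within distance 4 of all vertices but one corner.\<close>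
  have corner: "c \<in> M"
    if "{0..3} \<times> {0..5} \<subseteq> insert c (l1_ball x y 4)" "0 \<le> x" "x \<le> 3" "0 \<le> y" "y \<le> 5" for c x y
  proof (rule ccontr)
    assume "c \<notin> M"
    then have "M \<inter> l1_ball x y 4 = M" using that(1) box by blast
    then show False using ball[of x y 4] that big by simp
  qed
  let ?cs = "[(0, 0), (3, 0), (0, 5), (3, 5)] :: (int \<times> int) list"
  have "(0, 0) \<in> M" by (rule corner[of _ 2 3]) (auto simp: l1_ball_def)
  moreover have "(3, 0) \<in> M" by (rule corner[of _ 1 3]) (auto simp: l1_ball_def)
  moreover have "(0, 5) \<in> M" by (rule corner[of _ 2 2]) (auto simp: l1_ball_def)
  moreover have "(3, 5) \<in> M" by (rule corner[of _ 1 2]) (auto simp: l1_ball_def)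
  ultimately have cs: "set ?cs \<subseteq> M" by simp
  have "\<not> M \<subseteq> set ?cs"
    using big card_mono[of "set ?cs" M] by auto
  then obtain p where p: "p \<in> M" "p \<notin> set ?cs" by blast
  \<comment> \<open>Any fifth vertex added to the four corners overfills a ball of radius 1 or
    2.\<close>
  have "list_all (\<lambda>p. p \<in> set ?cs \<or> list_ex (\<lambda>x. list_ex (\<lambda>y. list_ex (\<lambda>r.
      r < int (length (filter (\<lambda>(s, t). \<bar>s - x\<bar> + \<bar>t - y\<bar> \<le> r) (p # ?cs)))) [1..2]) [0..5]) [0..3])
    (List.product [0..3] [0..5])"
    by code_simp
  moreover have "p \<in> set (List.product [0..3] [0..5])" using p(1) box by auto
  ultimately obtain x y r where xyr: "0 \<le> x" "x \<le> 3" "0 \<le> y" "y \<le> 5" "1 \<le> r"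
    and r: "r < int (length (filter (\<lambda>(s, t). \<bar>s - x\<bar> + \<bar>t - y\<bar> \<le> r) (p # ?cs)))"
    using p(2) unfolding list_all_iff list_ex_iff by (metis atLeastAtMost_iff set_upto)
  have "distinct (filter (\<lambda>(s, t). \<bar>s - x\<bar> + \<bar>t - y\<bar> \<le> r) (p # ?cs))"
    by (rule distinct_filter) (use p(2) in auto)
  then have "length (filter (\<lambda>(s, t). \<bar>s - x\<bar> + \<bar>t - y\<bar> \<le> r) (p # ?cs))
      = card (set (filter (\<lambda>(s, t). \<bar>s - x\<bar> + \<bar>t - y\<bar> \<le> r) (p # ?cs)))"
    by (rule distinct_card[symmetric])
  also have "\<dots> \<le> card (M \<inter> l1_ball x y r)"
    using fin cs p(1) by (intro card_mono) (auto simp: l1_ball_def)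
  finally show False using r ball[OF xyr] by linarith
qed

text \<open>Radii below \<open>L\<close> are checked by evaluation; from \<open>L\<close> on, the
  whole list is short enough.\<close>

lemma grid_broadcast_cost_ge:
  assumes "dominating_broadcast (grid n m) f" "set ps \<subseteq> {..<n} \<times> {..<m}"
    and check: "list_all (\<lambda>x. list_all (\<lambda>y. list_all (\<lambda>r.
      length (filter (\<lambda>u. l1_dist u (x, y) \<le> int r) ps) \<le> K * r) [1..<L]) [0..<m]) [0..<n]"
    and "length ps \<le> K * L"
  shows "length ps \<le> K * broadcast_cost (grid n m) f"
proof (rule broadcast_cost_ge[OF finite_grid assms(1)])
  show V: "set ps \<subseteq> verts (grid n m)" using assms(2) by (simp add: pverts_grid)
  fix v r assume v: "v \<in> verts (grid n m)" and r: "0 < (r :: nat)"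
  have eq: "filter (\<lambda>u. u \<in> graph_ball (grid n m) r v) ps = filter (\<lambda>u. l1_dist u v \<le> int r) ps"
    using V v by (intro filter_cong) (auto simp: grid_ball)
  show "length (filter (\<lambda>u. u \<in> graph_ball (grid n m) r v) ps) \<le> K * r"
  proof (cases "r < L")
    case True
    then show ?thesis using check v r unfolding eq list_all_iff
      by (cases v) (auto simp: pverts_grid)
  next
    case False
    have "length (filter (\<lambda>u. l1_dist u v \<le> int r) ps) \<le> length ps" by simp
    also have "\<dots> \<le> K * L" by fact
    also have "\<dots> \<le> K * r" using False by simp
    finally show ?thesis unfolding eq .
  qed
qed

text \<open>\<open>?ps\<close> lists each corner four times and the eight vertices of the two middle
  rows once. With \<open>K = 5\<close> these are weights 4/5 and 1/5, of total 24/5, which rounds up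
  to 5.\<close>

lemma broadcast_cost_4_6:
  assumes "dominating_broadcast (grid 4 6) f"
  shows "5 \<le> broadcast_cost (grid 4 6) f"
proof -
  let ?ps = "List.product [0, 3, 0, 3] [0, 5, 0, 5] @ List.product [0..<4] [2, 3] :: (nat \<times> nat) list"
  have "length ?ps \<le> 5 * broadcast_cost (grid 4 6) f"
  proof (rule grid_broadcast_cost_ge[OF assms, where L = 5])
    show "list_all (\<lambda>x. list_all (\<lambda>y. list_all (\<lambda>r.
      length (filter (\<lambda>u. l1_dist u (x, y) \<le> int r) ?ps) \<le> 5 * r) [1..<5]) [0..<6]) [0..<4]"
      by code_simp
  qed auto
  then show ?thesis by simp
qed

lemma broadcast_cost_6_4:
  assumes "dominating_broadcast (grid 6 4) f"
  shows "5 \<le> broadcast_cost (grid 6 4) f"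
proof -
  let ?ps = "List.product [0, 5, 0, 5] [0, 3, 0, 3] @ List.product [2, 3] [0..<4] :: (nat \<times> nat) list"
  have "length ?ps \<le> 5 * broadcast_cost (grid 6 4) f"
  proof (rule grid_broadcast_cost_ge[OF assms, where L = 5])
    show "list_all (\<lambda>x. list_all (\<lambda>y. list_all (\<lambda>r.
      length (filter (\<lambda>u. l1_dist u (x, y) \<le> int r) ?ps) \<le> 5 * r) [1..<5]) [0..<4]) [0..<6]"
      by code_simp
  qed auto
  then show ?thesis by simp
qed

text \<open>The four corners attain the upper bound; the orientation 6 by 4 is reduced to 4 by 6 by
  transposition.\<close>

lemma multipacking_4_6:
  assumes "(n, m) = (4, 6) \<or> (n, m) = (6, 4)"
  shows "multipacking_number (grid n m) = 4"
proof -
  let ?C = "{0, n - 1} \<times> {0, m - 1}"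
  show ?thesis
  proof (rule multipacking_number_eqI[OF finite_grid, of _ _ ?C])
    show "card ?C = 4" using assms by (auto simp: card_cartesian_product)
    let ?c46 = "[(0, 0), (0, 5), (3, 0), (3, 5)] :: (int \<times> int) list"
    have "box_packing 3 5 (set ?c46)" by (rule box_packing_check) (code_simp, auto)
    moreover from box_packing_swap[OF this]
    have "box_packing 5 3 (set [(0, 0), (0, 3), (5, 0), (5, 3)])" by (simp add: insert_commute)
    ultimately show "multipacking (grid n m) ?C"
      using assms unfolding multipacking_grid_iff by (auto simp: insert_commute)
    fix N assume "multipacking (grid n m) N"
    then have "box_packing (int n - 1) (int m - 1) (map_prod int int ` N)"
      by (simp add: multipacking_grid_iff)
    then have "card (map_prod int int ` N) \<le> 4"
    proof (cases "n = 4")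
      case False
      then have "box_packing 3 5 (prod.swap ` map_prod int int ` N)"
        using assms \<open>box_packing (int n - 1) (int m - 1) _\<close> box_packing_swap by fastforce
      from box_packing_4_6_card_le[OF this] show ?thesis
        by (simp add: card_image)
    qed (use assms box_packing_4_6_card_le in auto)
    then show "card N \<le> 4"
      by (simp add: card_image[OF inj_on_subset[OF inj_map_prod_int]])
  qed
qed

text \<open>The central broadcast costs 2 + 3 and meets the fractional lower bound.\<close>

lemma broadcast_4_6:
  assumes "(n, m) = (4, 6) \<or> (n, m) = (6, 4)"
  shows "broadcast_number (grid n m) = 5"
proof -
  have "2 \<le> n" "2 \<le> m" using assms by auto
  from grid_radius_broadcast[OF this] show ?thesis
    using assms broadcast_cost_4_6 broadcast_cost_6_4 by (intro broadcast_number_eqI) auto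
qed

section \<open>The isomorphism of the two orientations and the conclusion\<close>

lemma digraph_iso_cart_prod_swap:
  assumes "pair_graph G" "pair_graph H"
  shows "digraph_iso (G \<box> H) (H \<box> G)"
proof -
  interpret pair_graph "G \<box> H" using assms by (rule pair_graph_cart_prod)
  let ?f = "\<lparr> iso_verts = prod.swap, iso_arcs = map_prod prod.swap prod.swap,
    iso_head = snd, iso_tail = fst \<rparr>
    :: ('a \<times> 'b, ('a \<times> 'b) \<times> 'a \<times> 'b, 'b \<times> 'a, ('b \<times> 'a) \<times> 'b \<times> 'a) digraph_isomorphism"
  have "pre_digraph.digraph_isomorphism (G \<box> H) ?f"
    unfolding digraph_isomorphism_def using wf_digraph_axioms by (auto simp: inj_on_def)
  moreover have "with_proj (H \<box> G) = app_iso ?f (G \<box> H)"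
    by (force simp: with_proj_def app_iso_def cart_prod_def image_iff)
  ultimately show ?thesis unfolding digraph_iso_def by blast
qed

theorem theorem1:
  fixes n m :: nat
  assumes "n \<ge> 4" and "m \<ge> 4"
  shows "((n, m) \<noteq> (4, 6) \<and> (n, m) \<noteq> (6, 4) \<longrightarrow>
            multipacking_number (path_graph n \<box> path_graph m)
              = broadcast_number (path_graph n \<box> path_graph m)) \<and>
         ((n, m) = (4, 6) \<or> (n, m) = (6, 4) \<longrightarrow>
            multipacking_number (path_graph n \<box> path_graph m) = 4 \<and>
            broadcast_number (path_graph n \<box> path_graph m) = 5) \<and>
         digraph_iso (path_graph 4 \<box> path_graph 6) (path_graph 6 \<box> path_graph 4)"
proof (intro conjI impI)
  assume "(n, m) \<noteq> (4, 6) \<and> (n, m) \<noteq> (6, 4)"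
  then obtain B where "box_packing (int n - 1) (int m - 1) B" "card B = n div 2 + m div 2"
    using box_packing_exists assms by blast
  then show "multipacking_number (path_graph n \<box> path_graph m)
      = broadcast_number (path_graph n \<box> path_graph m)"
    using grid_numbers_eq_radius[of n m B] assms by simp
next
  assume "(n, m) = (4, 6) \<or> (n, m) = (6, 4)"
  then show "multipacking_number (path_graph n \<box> path_graph m) = 4"
    and "broadcast_number (path_graph n \<box> path_graph m) = 5"
    by (rule multipacking_4_6 broadcast_4_6)+
next
  show "digraph_iso (path_graph 4 \<box> path_graph 6) (path_graph 6 \<box> path_graph 4)"
    by (intro digraph_iso_cart_prod_swap pair_graph_path_graph)
qed

end
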